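(* Let $\mathbb{K}$ be a field of characteristic zero and let $(\mathfrak{g},B,\omega)$ be a finite-dimensional quadratic symplectic Lie superalgebra of filiform type over $\mathbb{K}$, with flag $\mathfrak{g}_{\bar 1}=V_m\supset\dots\supset V_1\supset V_0$, $m=\dim\mathfrak{g}_{\bar 1}$. (i) If $\dim\mathfrak{g}_{\bar 1}=2$, then $(\mathfrak{g},B,\omega)$ is an elementary odd double extension of a quadratic symplectic Lie algebra by a one-dimensional Lie superalgebra $(\mathbb{K}e)_{\bar 1}$. (ii) If $\dim\mathfrak{g}_{\bar 1}>2$, then $(\mathfrak{g},B,\omega)$ is the generalized (quadratic symplectic) double extension of a quadratic symplectic Lie superalgebra of filiform type $(\tilde{\mathfrak{g}},\tilde{B},\tilde{\omega})$, with $\dim\tilde{\mathfrak{g}}=\dim\mathfrak{g}-2$, by a one-dimensional Lie superalgebra $(\mathbb{K}e_m)_{\bar 1}$, where $e_m\in V_m\setminus V_{m-1}$.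
   Context: A Lie superalgebra is a $\mathbb{Z}_2$-graded vector space $\mathfrak{g}=\mathfrak{g}_{\bar 0}\oplus\mathfrak{g}_{\bar 1}$ with an even bilinear bracket satisfying, for homogeneous $X,Y,Z$ of degrees $x,y,z$, $[X,Y]=-(-1)^{xy}[Y,X]$ and $(-1)^{xz}[X,[Y,Z]]+(-1)^{xy}[Y,[Z,X]]+(-1)^{yz}[Z,[X,Y]]=0$. A bilinear form $F$ is even if $F(\mathfrak{g}_{\bar 0},\mathfrak{g}_{\bar 1})=F(\mathfrak{g}_{\bar 1},\mathfrak{g}_{\bar 0})=\{0\}$. $(\mathfrak{g},B)$ is quadratic if $B$ is an even, non-degenerate, supersymmetric ($B(X,Y)=(-1)^{xy}B(Y,X)$), invariant ($B([X,Y],Z)=B(X,[Y,Z])$) bilinear form. A symplectic structure is an even, non-degenerate, skew-supersymmetric ($\omega(X,Y)=-(-1)^{xy}\omega(Y,X)$) bilinear form with $(-1)^{xz}\omega(X,[Y,Z])+(-1)^{yx}\omega(Y,[Z,X])+(-1)^{zy}\omega(Z,[X,Y])=0$. A quadratic symplectic Lie superalgebra $(\mathfrak{g},B,\omega)$ carries both; it is a quadratic symplectic Lie algebra when $\mathfrak{g}_{\bar 1}=\{0\}$. A superderivation of degree $d$ is a linear map $D$ homogeneous of degree $d$ with $D([X,Y])=[D(X),Y]+(-1)^{dx}[X,D(Y)]$; it is skew-supersymmetric if $B(D(X),Y)=-(-1)^{dx}B(X,D(Y))$ for $X\in\mathfrak{g}_x$. The symplectic structures on a quadratic $(\mathfrak{g},B)$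 are exactly the forms $\omega=B(\delta(\cdot),\cdot)$ with $\delta$ a (unique) even invertible skew-supersymmetric superderivation. $\mathfrak{g}$ with $\dim\mathfrak{g}_{\bar 1}=m>0$ is of filiform type if there is a flag $\mathfrak{g}_{\bar 1}=V_m\supset\dots\supset V_1\supset V_0$ with $\dim V_i=i$ and $[\mathfrak{g}_{\bar 0},V_{i+1}]=V_i$ for $0\le i\le m-1$. Elementary odd double extension (symplectic version): start with a quadratic symplectic Lie algebra $(\mathfrak{h},B_{\mathfrak{h}},\omega_{\mathfrak{h}}=B_{\mathfrak{h}}(\delta_{\mathfrak{h}}\cdot,\cdot))$, $X_0\in\mathfrak{z}(\mathfrak{h})\setminus\{0\}$ (center) with $B_{\mathfrak{h}}(X_0,X_0)=0$ and $\delta_{\mathfrak{h}}(X_0)=\beta X_0$, $\beta\in\mathbb{K}\setminus\{0\}$. It is $\mathbb{K}e\oplus\mathfrak{h}\oplus\mathbb{K}e^*$ with $\mathfrak{h}$ even, $e,e^*$ odd, brackets $[e,e]=X_0$, $e^*$ central, $[e,X]=-B_{\mathfrak{h}}(X,X_0)e^*$, $[X,Y]=[X,Y]_{\mathfrak{h}}$ for $X,Y\in\mathfrak{h}$; supersymmetric form $B$ extending $B_{\mathfrak{h}}$ with $B(e^*,e)=1$, $B(\mathfrak{h},e)=B(\mathfrak{h},e^* )=\{0\}$, $B(e,e)=B(e^*,e^* )=0$; and $\omega=B(\delta\cdot,\cdot)$ where $\delta(e^* )=-\frac{\beta}{2}e^*$, $\delta(e)=\frac{\beta}{2}e$, $\delta|_{\mathfrak{h}}=\delta_{\mathfrak{h}}$.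 Generalized quadratic symplectic double extension: start with a quadratic symplectic Lie superalgebra of filiform type $(\mathfrak{h},B_{\mathfrak{h}},\omega_{\mathfrak{h}}=B_{\mathfrak{h}}(\delta_{\mathfrak{h}}\cdot,\cdot))$ with flag $\mathfrak{h}_{\bar 1}=W_n\supset\dots\supset W_0$, an odd skew-supersymmetric superderivation $D$ of $(\mathfrak{h},B_{\mathfrak{h}})$, $X_0\in\mathfrak{h}_{\bar 0}\setminus\{0\}$ with $D(X_0)=0$, $B_{\mathfrak{h}}(X_0,X_0)=0$, $D^2=\frac12[X_0,\cdot]_{\mathfrak{h}}$, $D(\mathfrak{h}_{\bar 0})$ containing an element of $W_n\setminus W_{n-1}$, and $\alpha\in\mathbb{K}\setminus\{0\}$, $\mu\in\mathbb{K}$, $A_1\in\mathfrak{h}_{\bar 1}$ with $\delta_{\mathfrak{h}}D-D\delta_{\mathfrak{h}}+\alpha D=[A_1,\cdot]_{\mathfrak{h}}$ and $D(A_1)=\alpha X_0+\frac12\delta_{\mathfrak{h}}(X_0)$. It is $\mathbb{K}e\oplus\mathfrak{h}\oplus\mathbb{K}e^*$ with $e,e^*$ odd, brackets $[e,e]=X_0$, $e^*$ central, $[e,X]=D(X)-B_{\mathfrak{h}}(X,X_0)e^*$, $[X,Y]=[X,Y]_{\mathfrak{h}}-B_{\mathfrak{h}}(D(X),Y)e^*$ for $X,Y\in\mathfrak{h}$; supersymmetric form $B$ extending $B_{\mathfrak{h}}$ with $B(e^*,e)=1$, $B(\mathfrak{h},e)=B(\mathfrak{h},e^* )=\{0\}$,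 $B(e,e)=B(e^*,e^* )=0$; and $\omega=B(\delta\cdot,\cdot)$ where $\delta(e^* )=\alpha e^*$, $\delta(e)=\mu e^*+A_1-\alpha e$, $\delta(X)=\delta_{\mathfrak{h}}(X)-B_{\mathfrak{h}}(X,A_1)e^*$ for $X\in\mathfrak{h}$. In (ii), $e_m$ plays the role of $e$. "$(\mathfrak{g},B,\omega)$ is an extension" of one of these kinds means it is isomorphic to such an extension by a Lie superalgebra isomorphism preserving both forms. *)

theory Defs
  imports Complex_Main "HOL-Library.Z2" "HOL-Library.Product_Plus"
begin

text \<open>
  A superalgebra is given by two subspaces \<open>grade L 0\<close>, \<open>grade L 1\<close> of an ambient vector space
  \<open>('a, scl L)\<close>; degrees live in the two-element field \<open>bit\<close>. The underlying vector space is
  \<open>carr L\<close>, the direct sum of the two subspaces; the values of brackets, forms and maps outside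
  it are irrelevant, and every condition below is relativised to it. Working with subspaces,
  rather than with whole types, lets one quantify existentially over superalgebras of smaller
  dimension.
\<close>

record ('k, 'a) superalgebra =
  scl :: "'k \<Rightarrow> 'a \<Rightarrow> 'a"
  grade :: "bit \<Rightarrow> 'a set"
  brk :: "'a \<Rightarrow> 'a \<Rightarrow> 'a"

definition carr :: "('k, 'a::ab_group_add) superalgebra \<Rightarrow> 'a set" where
  "carr L = {x + y | x y. x \<in> grade L 0 \<and> y \<in> grade L 1}"

definition psign :: "bit \<Rightarrow> 'k::comm_ring_1" where
  "psign d = (if d = 0 then 1 else - 1)"

definition linear_from ::
  "('k \<Rightarrow> 'a \<Rightarrow> 'a) \<Rightarrow> ('k \<Rightarrow> 'b \<Rightarrow> 'b) \<Rightarrow> 'a::ab_group_add set \<Rightarrow> ('a \<Rightarrow> 'b::ab_group_add) \<Rightarrow> bool"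
where
  "linear_from s t S f \<longleftrightarrow>
     (\<forall>x\<in>S. \<forall>y\<in>S. f (x + y) = f x + f y) \<and> (\<forall>c. \<forall>x\<in>S. f (s c x) = t c (f x))"

definition bilinear_from ::
  "('k \<Rightarrow> 'a \<Rightarrow> 'a) \<Rightarrow> ('k \<Rightarrow> 'b \<Rightarrow> 'b) \<Rightarrow> 'a::ab_group_add set \<Rightarrow> ('a \<Rightarrow> 'a \<Rightarrow> 'b::ab_group_add) \<Rightarrow> bool"
where
  "bilinear_from s t S f \<longleftrightarrow>
     (\<forall>x\<in>S. linear_from s t S (f x)) \<and> (\<forall>y\<in>S. linear_from s t S (\<lambda>x. f x y))"

definition lie_superalgebra :: "('k::field, 'a::ab_group_add) superalgebra \<Rightarrow> bool" where
  "lie_superalgebra L \<longleftrightarrow>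
     vector_space (scl L) \<and>
     (\<forall>i. module.subspace (scl L) (grade L i)) \<and> grade L 0 \<inter> grade L 1 = {0} \<and>
     bilinear_from (scl L) (scl L) (carr L) (brk L) \<and>
     (\<forall>i j. \<forall>X\<in>grade L i. \<forall>Y\<in>grade L j. brk L X Y \<in> grade L (i + j)) \<and>
     (\<forall>x y. \<forall>X\<in>grade L x. \<forall>Y\<in>grade L y.
        brk L X Y = - scl L (psign (x * y)) (brk L Y X)) \<and>
     (\<forall>x y z. \<forall>X\<in>grade L x. \<forall>Y\<in>grade L y. \<forall>Z\<in>grade L z.
        scl L (psign (x * z)) (brk L X (brk L Y Z))
        + scl L (psign (x * y)) (brk L Y (brk L Z X))
        + scl L (psign (y * z)) (brk L Z (brk L X Y)) = 0)"

definition finite_dim :: "('k::field, 'a::ab_group_add) superalgebra \<Rightarrow> bool" where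
  "finite_dim L \<longleftrightarrow> (\<exists>S. finite S \<and> S \<subseteq> carr L \<and> module.span (scl L) S = carr L)"

definition center :: "('k, 'a::ab_group_add) superalgebra \<Rightarrow> 'a set" where
  "center L = {Z \<in> carr L. \<forall>X\<in>carr L. brk L Z X = 0}"


definition even_nondegenerate_form ::
  "('k::field, 'a::ab_group_add) superalgebra \<Rightarrow> ('a \<Rightarrow> 'a \<Rightarrow> 'k) \<Rightarrow> bool" where
  "even_nondegenerate_form L F \<longleftrightarrow>
     bilinear_from (scl L) (*) (carr L) F \<and>
     (\<forall>X\<in>grade L 0. \<forall>Y\<in>grade L 1. F X Y = 0 \<and> F Y X = 0) \<and>
     (\<forall>X\<in>carr L. (\<forall>Y\<in>carr L. F X Y = 0) \<longrightarrow> X = 0)"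

definition quadratic ::
  "('k::field, 'a::ab_group_add) superalgebra \<Rightarrow> ('a \<Rightarrow> 'a \<Rightarrow> 'k) \<Rightarrow> bool" where
  "quadratic L B \<longleftrightarrow>
     lie_superalgebra L \<and> even_nondegenerate_form L B \<and>
     (\<forall>x y. \<forall>X\<in>grade L x. \<forall>Y\<in>grade L y. B X Y = psign (x * y) * B Y X) \<and>
     (\<forall>X\<in>carr L. \<forall>Y\<in>carr L. \<forall>Z\<in>carr L. B (brk L X Y) Z = B X (brk L Y Z))"

definition symplectic ::
  "('k::field, 'a::ab_group_add) superalgebra \<Rightarrow> ('a \<Rightarrow> 'a \<Rightarrow> 'k) \<Rightarrow> bool" where
  "symplectic L \<omega> \<longleftrightarrow>
     lie_superalgebra L \<and> even_nondegenerate_form L \<omega> \<and>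
     (\<forall>x y. \<forall>X\<in>grade L x. \<forall>Y\<in>grade L y. \<omega> X Y = - psign (x * y) * \<omega> Y X) \<and>
     (\<forall>x y z. \<forall>X\<in>grade L x. \<forall>Y\<in>grade L y. \<forall>Z\<in>grade L z.
        psign (x * z) * \<omega> X (brk L Y Z) + psign (y * x) * \<omega> Y (brk L Z X)
        + psign (z * y) * \<omega> Z (brk L X Y) = 0)"

definition quadratic_symplectic ::
  "('k::field, 'a::ab_group_add) superalgebra \<Rightarrow> ('a \<Rightarrow> 'a \<Rightarrow> 'k) \<Rightarrow> ('a \<Rightarrow> 'a \<Rightarrow> 'k) \<Rightarrow> bool" where
  "quadratic_symplectic L B \<omega> \<longleftrightarrow> quadratic L B \<and> symplectic L \<omega>"

definition superderivation ::
  "('k::field, 'a::ab_group_add) superalgebra \<Rightarrow> bit \<Rightarrow> ('a \<Rightarrow> 'a) \<Rightarrow> bool" where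
  "superderivation L d D \<longleftrightarrow>
     linear_from (scl L) (scl L) (carr L) D \<and>
     (\<forall>i. D ` grade L i \<subseteq> grade L (d + i)) \<and>
     (\<forall>x. \<forall>X\<in>grade L x. \<forall>Y\<in>carr L.
        D (brk L X Y) = brk L (D X) Y + scl L (psign (d * x)) (brk L X (D Y)))"

definition skew_superderivation ::
  "('k::field, 'a::ab_group_add) superalgebra \<Rightarrow> ('a \<Rightarrow> 'a \<Rightarrow> 'k) \<Rightarrow> bit \<Rightarrow> ('a \<Rightarrow> 'a) \<Rightarrow> bool" where
  "skew_superderivation L B d D \<longleftrightarrow>
     superderivation L d D \<and>
     (\<forall>x. \<forall>X\<in>grade L x. \<forall>Y\<in>carr L. B (D X) Y = - psign (d * x) * B X (D Y))"

text \<open>\<open>\<delta>\<close> is the map with \<open>\<omega> = B(\<delta>(\<cdot>), \<cdot>)\<close>.\<close>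

definition represents_symplectic ::
  "('k::field, 'a::ab_group_add) superalgebra \<Rightarrow> ('a \<Rightarrow> 'a \<Rightarrow> 'k) \<Rightarrow> ('a \<Rightarrow> 'a \<Rightarrow> 'k) \<Rightarrow> ('a \<Rightarrow> 'a) \<Rightarrow> bool"
where
  "represents_symplectic L B \<omega> \<delta> \<longleftrightarrow>
     skew_superderivation L B 0 \<delta> \<and> bij_betw \<delta> (carr L) (carr L) \<and>
     (\<forall>X\<in>carr L. \<forall>Y\<in>carr L. \<omega> X Y = B (\<delta> X) Y)"

text \<open>\<open>[\<gg>\<^sub>0, V]\<close> denotes, as usual, the linear span of the brackets. The conditions force \<open>m\<close> to be
  the dimension of the odd part.\<close>

definition filiform_flag ::
  "('k::field, 'a::ab_group_add) superalgebra \<Rightarrow> nat \<Rightarrow> (nat \<Rightarrow> 'a set) \<Rightarrow> bool" where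
  "filiform_flag L m V \<longleftrightarrow>
     0 < m \<and> V m = grade L 1 \<and>
     (\<forall>i\<le>m. module.subspace (scl L) (V i) \<and> vector_space.dim (scl L) (V i) = i) \<and>
     (\<forall>i<m. V i \<subseteq> V (Suc i) \<and>
        module.span (scl L) {brk L X v | X v. X \<in> grade L 0 \<and> v \<in> V (Suc i)} = V i)"

definition qs_isomorphism ::
  "('k::field, 'a::ab_group_add) superalgebra \<Rightarrow> ('a \<Rightarrow> 'a \<Rightarrow> 'k) \<Rightarrow> ('a \<Rightarrow> 'a \<Rightarrow> 'k) \<Rightarrow>
   ('k, 'b::ab_group_add) superalgebra \<Rightarrow> ('b \<Rightarrow> 'b \<Rightarrow> 'k) \<Rightarrow> ('b \<Rightarrow> 'b \<Rightarrow> 'k) \<Rightarrow> ('a \<Rightarrow> 'b) \<Rightarrow> bool"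
where
  "qs_isomorphism L B \<omega> L' B' \<omega>' \<phi> \<longleftrightarrow>
     linear_from (scl L) (scl L') (carr L) \<phi> \<and> bij_betw \<phi> (carr L) (carr L') \<and>
     (\<forall>i. \<phi> ` grade L i \<subseteq> grade L' i) \<and>
     (\<forall>X\<in>carr L. \<forall>Y\<in>carr L. \<phi> (brk L X Y) = brk L' (\<phi> X) (\<phi> Y) \<and>
        B' (\<phi> X) (\<phi> Y) = B X Y \<and> \<omega>' (\<phi> X) (\<phi> Y) = \<omega> X Y)"


text \<open>
  The space \<open>\<K>e \<oplus> \<hh> \<oplus> \<K>e\<^sup>*\<close> of a double extension is realised in the product type
  \<open>'k \<times> 'a \<times> 'k\<close>: the triple \<open>(a, X, b)\<close> stands for \<open>a e + X + b e\<^sup>*\<close>. Both \<open>e\<close> and \<open>e\<^sup>*\<close> are odd,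
  so supersymmetry turns \<open>B(e\<^sup>*, e) = 1\<close> into \<open>B(e, e\<^sup>*) = - 1\<close>.
\<close>

fun ext_scl :: "('k::field, 'a::ab_group_add) superalgebra \<Rightarrow> 'k \<Rightarrow> 'k \<times> 'a \<times> 'k \<Rightarrow> 'k \<times> 'a \<times> 'k" where
  "ext_scl H c (a, X, b) = (c * a, scl H c X, c * b)"

definition ext_grade :: "('k::field, 'a::ab_group_add) superalgebra \<Rightarrow> bit \<Rightarrow> ('k \<times> 'a \<times> 'k) set" where
  "ext_grade H i = (if i = 0 then {0} \<times> grade H 0 \<times> {0} else UNIV \<times> grade H 1 \<times> UNIV)"

fun ext_form :: "('a \<Rightarrow> 'a \<Rightarrow> 'k::field) \<Rightarrow> 'k \<times> 'a \<times> 'k \<Rightarrow> 'k \<times> 'a \<times> 'k \<Rightarrow> 'k" where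
  "ext_form B (a, X, b) (a', X', b') = B X X' + b * a' - a * b'"


text \<open>Here \<open>\<hh>\<close> is even, so that \<open>[X, e] = - [e, X] = B(X, X\<^sub>0) e\<^sup>*\<close>.\<close>

fun elem_brk ::
  "('k::field, 'a::ab_group_add) superalgebra \<Rightarrow> ('a \<Rightarrow> 'a \<Rightarrow> 'k) \<Rightarrow> 'a \<Rightarrow>
   'k \<times> 'a \<times> 'k \<Rightarrow> 'k \<times> 'a \<times> 'k \<Rightarrow> 'k \<times> 'a \<times> 'k" where
  "elem_brk H B X0 (a, X, b) (a', X', b') =
     (0, scl H (a * a') X0 + brk H X X', - a * B X' X0 + a' * B X X0)"

definition elem_ext ::
  "('k::field, 'a::ab_group_add) superalgebra \<Rightarrow> ('a \<Rightarrow> 'a \<Rightarrow> 'k) \<Rightarrow> 'a \<Rightarrow>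
   ('k, 'k \<times> 'a \<times> 'k) superalgebra" where
  "elem_ext H B X0 = \<lparr>scl = ext_scl H, grade = ext_grade H, brk = elem_brk H B X0\<rparr>"

fun elem_delta :: "('a \<Rightarrow> 'a) \<Rightarrow> 'k::field \<Rightarrow> 'k \<times> 'a \<times> 'k \<Rightarrow> 'k \<times> 'a \<times> 'k" where
  "elem_delta \<delta> \<beta> (a, X, b) = (\<beta> / 2 * a, \<delta> X, - \<beta> / 2 * b)"

definition elem_ext_data ::
  "('k::field, 'a::ab_group_add) superalgebra \<Rightarrow> ('a \<Rightarrow> 'a \<Rightarrow> 'k) \<Rightarrow> ('a \<Rightarrow> 'a \<Rightarrow> 'k) \<Rightarrow>
   ('a \<Rightarrow> 'a) \<Rightarrow> 'a \<Rightarrow> 'k \<Rightarrow> bool" where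
  "elem_ext_data H B \<omega> \<delta> X0 \<beta> \<longleftrightarrow>
     quadratic_symplectic H B \<omega> \<and> grade H 1 = {0} \<and> represents_symplectic H B \<omega> \<delta> \<and>
     X0 \<in> center H \<and> X0 \<noteq> 0 \<and> B X0 X0 = 0 \<and> \<beta> \<noteq> 0 \<and> \<delta> X0 = scl H \<beta> X0"

text \<open>
  \<open>\<hh>\<close> may be sought in the ambient space of \<open>L\<close>, since it embeds into \<open>L\<close>.
\<close>

definition elementary_odd_double_extension ::
  "('k::field, 'a::ab_group_add) superalgebra \<Rightarrow> ('a \<Rightarrow> 'a \<Rightarrow> 'k) \<Rightarrow> ('a \<Rightarrow> 'a \<Rightarrow> 'k) \<Rightarrow> bool" where
  "elementary_odd_double_extension L B \<omega> \<longleftrightarrow>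
     (\<exists>(H :: ('k, 'a) superalgebra) B\<^sub>H \<omega>\<^sub>H \<delta>\<^sub>H X0 \<beta> \<phi>.
        elem_ext_data H B\<^sub>H \<omega>\<^sub>H \<delta>\<^sub>H X0 \<beta> \<and>
        qs_isomorphism (elem_ext H B\<^sub>H X0) (ext_form B\<^sub>H)
          (\<lambda>u v. ext_form B\<^sub>H (elem_delta \<delta>\<^sub>H \<beta> u) v) L B \<omega> \<phi>)"


text \<open>
  In the generalized extension \<open>\<hh>\<close> has an odd part. For homogeneous \<open>X\<close> of degree \<open>x\<close> one has
  \<open>[X, e] = - (-1)\<^sup>x [e, X]\<close>, i.e. \<open>[X, e] = - [e, \<sigma> X]\<close> for the grading automorphism \<open>\<sigma>\<close>.
\<close>

definition parity_aut :: "('k, 'a::ab_group_add) superalgebra \<Rightarrow> 'a \<Rightarrow> 'a" where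
  "parity_aut L X = (THE Y. \<exists>X\<^sub>0\<in>grade L 0. \<exists>X\<^sub>1\<in>grade L 1. X = X\<^sub>0 + X\<^sub>1 \<and> Y = X\<^sub>0 - X\<^sub>1)"

fun gen_brk ::
  "('k::field, 'a::ab_group_add) superalgebra \<Rightarrow> ('a \<Rightarrow> 'a \<Rightarrow> 'k) \<Rightarrow> ('a \<Rightarrow> 'a) \<Rightarrow> 'a \<Rightarrow>
   'k \<times> 'a \<times> 'k \<Rightarrow> 'k \<times> 'a \<times> 'k \<Rightarrow> 'k \<times> 'a \<times> 'k" where
  "gen_brk H B D X0 (a, X, b) (a', X', b') =
     (0,
      scl H (a * a') X0 + scl H a (D X') - scl H a' (D (parity_aut H X)) + brk H X X',
      - a * B X' X0 + a' * B (parity_aut H X) X0 - B (D X) X')"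

definition gen_ext ::
  "('k::field, 'a::ab_group_add) superalgebra \<Rightarrow> ('a \<Rightarrow> 'a \<Rightarrow> 'k) \<Rightarrow> ('a \<Rightarrow> 'a) \<Rightarrow> 'a \<Rightarrow>
   ('k, 'k \<times> 'a \<times> 'k) superalgebra" where
  "gen_ext H B D X0 = \<lparr>scl = ext_scl H, grade = ext_grade H, brk = gen_brk H B D X0\<rparr>"

fun gen_delta ::
  "('k::field, 'a::ab_group_add) superalgebra \<Rightarrow> ('a \<Rightarrow> 'a \<Rightarrow> 'k) \<Rightarrow> ('a \<Rightarrow> 'a) \<Rightarrow> 'k \<Rightarrow> 'k \<Rightarrow> 'a \<Rightarrow>
   'k \<times> 'a \<times> 'k \<Rightarrow> 'k \<times> 'a \<times> 'k" where
  "gen_delta H B \<delta> \<alpha> \<mu> A1 (a, X, b) =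
     (- \<alpha> * a, \<delta> X + scl H a A1, \<alpha> * b + \<mu> * a - B X A1)"

definition gen_ext_data ::
  "('k::field, 'a::ab_group_add) superalgebra \<Rightarrow> ('a \<Rightarrow> 'a \<Rightarrow> 'k) \<Rightarrow> ('a \<Rightarrow> 'a \<Rightarrow> 'k) \<Rightarrow> ('a \<Rightarrow> 'a) \<Rightarrow>
   nat \<Rightarrow> (nat \<Rightarrow> 'a set) \<Rightarrow> ('a \<Rightarrow> 'a) \<Rightarrow> 'a \<Rightarrow> 'k \<Rightarrow> 'a \<Rightarrow> bool" where
  "gen_ext_data H B \<omega> \<delta> n W D X0 \<alpha> A1 \<longleftrightarrow>
     quadratic_symplectic H B \<omega> \<and> represents_symplectic H B \<omega> \<delta> \<and> filiform_flag H n W \<and>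
     skew_superderivation H B 1 D \<and>
     X0 \<in> grade H 0 \<and> X0 \<noteq> 0 \<and> D X0 = 0 \<and> B X0 X0 = 0 \<and>
     (\<forall>X\<in>carr H. D (D X) = scl H (1 / 2) (brk H X0 X)) \<and>
     (\<exists>X\<in>grade H 0. D X \<in> W n - W (n - 1)) \<and>
     \<alpha> \<noteq> 0 \<and> A1 \<in> grade H 1 \<and>
     (\<forall>X\<in>carr H. \<delta> (D X) - D (\<delta> X) + scl H \<alpha> (D X) = brk H A1 X) \<and>
     D A1 = scl H \<alpha> X0 + scl H (1 / 2) (\<delta> X0)"

text \<open>\<open>(L, B, \<omega>)\<close> is a generalized double extension of \<open>(H, B\<^sub>H, \<omega>\<^sub>H)\<close>, where the element \<open>e\<close> of
  the extension corresponds to \<open>e\<^sub>L\<close> in \<open>L\<close>.\<close>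

definition generalized_double_extension_of ::
  "('k::field, 'b::ab_group_add) superalgebra \<Rightarrow> ('b \<Rightarrow> 'b \<Rightarrow> 'k) \<Rightarrow> ('b \<Rightarrow> 'b \<Rightarrow> 'k) \<Rightarrow> 'b \<Rightarrow>
   ('k, 'a::ab_group_add) superalgebra \<Rightarrow> ('a \<Rightarrow> 'a \<Rightarrow> 'k) \<Rightarrow> ('a \<Rightarrow> 'a \<Rightarrow> 'k) \<Rightarrow> bool" where
  "generalized_double_extension_of L B \<omega> e\<^sub>L H B\<^sub>H \<omega>\<^sub>H \<longleftrightarrow>
     (\<exists>\<delta>\<^sub>H n W D X0 \<alpha> \<mu> A1 \<phi>.
        gen_ext_data H B\<^sub>H \<omega>\<^sub>H \<delta>\<^sub>H n W D X0 \<alpha> A1 \<and>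
        qs_isomorphism (gen_ext H B\<^sub>H D X0) (ext_form B\<^sub>H)
          (\<lambda>u v. ext_form B\<^sub>H (gen_delta H B\<^sub>H \<delta>\<^sub>H \<alpha> \<mu> A1 u) v) L B \<omega> \<phi> \<and>
        \<phi> (1, 0, 0) = e\<^sub>L)"

end

theory Submission
  imports Defs
begin

text \<open>
  The line \<open>V\<^sub>1 = \<K>f\<close> is killed by \<open>\<gg>\<^sub>0\<close>, so by invariance it is orthogonal to
  \<open>V\<^bsub>m-1\<^esub> = [\<gg>\<^sub>0, \<gg>\<^sub>1]\<close>, hence central, and \<open>V\<^bsub>m-1\<^esub>\<close> is its orthogonal in \<open>\<gg>\<^sub>1\<close>. Any
  \<open>e \<in> V\<^sub>m - V\<^bsub>m-1\<^esub>\<close> therefore spans with \<open>f\<close> a hyperbolic plane, and \<open>e\<close> can be chosen with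
  \<open>[e, e] \<noteq> 0\<close>. The reduced algebra is \<open>f\<^sup>\<bottom> / \<K>f\<close>, identified with the orthogonal complement
  \<open>\<hh>\<close> of that plane, and \<open>\<gg>\<close> is recovered from it with \<open>D = [e, \<cdot>]\<close>, \<open>X\<^sub>0 = [e, e]\<close> and \<open>A\<^sub>1\<close> the
  component of \<open>\<delta>(e)\<close> in \<open>\<hh>\<close>, where \<open>\<omega> = B(\<delta>(\<cdot>), \<cdot>)\<close>. The derivation \<open>\<delta>\<close> preserves the flag,
  which makes \<open>f\<close> an eigenvector. If \<open>m = 2\<close>, then \<open>A\<^sub>1 = 0\<close> and adding a multiple of \<open>f\<close> to \<open>e\<close>
  makes \<open>e\<close> an eigenvector as well.
\<close>

section \<open>Finite-dimensional subspaces and representation of functionals\<close>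

context vector_space
begin

text \<open>Independent subsets of a finitely generated span are finite, so any basis of
  \<open>S\<close> serves. The ambient space itself need not be finite-dimensional.\<close>

lemma finite_basis_of_subspace:
  assumes "subspace S" "S \<subseteq> span T" "finite T"
  obtains A where "finite A" "A \<subseteq> S" "independent A" "span A = S" "card A = dim S"
proof -
  obtain A where A: "A \<subseteq> S" "independent A" "S \<subseteq> span A" "card A = dim S"
    using basis_exists by blast
  have "finite A"
    using independent_span_bound[OF \<open>finite T\<close> A(2)] A(1) assms(2) by blast
  moreover have "span A = S"
    using A(1,3) assms(1) span_minimal by blast
  ultimately show thesis
    using A that by blast
qed

text \<open>Adding \<open>e\<close> to a basis of \<open>S\<close> gives a basis of
  \<open>U\<close>. This counts dimensions when one vector is split off, both for the reduced
  algebra and for its flag.\<close>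

lemma dim_hyperplane:
  assumes "subspace S" "subspace U" "S \<subseteq> U" "U \<subseteq> span T" "finite T"
    and "e \<in> U" "e \<notin> S" "\<And>u. u \<in> U \<Longrightarrow> \<exists>c. u - scale c e \<in> S"
  shows "dim U = Suc (dim S)"
proof -
  obtain A where A: "finite A" "A \<subseteq> S" "independent A" "span A = S" "card A = dim S"
    using finite_basis_of_subspace[OF assms(1) _ assms(5)] assms(3,4) by blast
  have "independent (insert e A)"
    using A assms(7) independent_insertI by metis
  moreover have "U \<subseteq> span (insert e A)"
    using assms(8) A(4) by (auto simp: span_insert)
  moreover have "insert e A \<subseteq> U"
    using A(2) assms(3,6) by blast
  moreover have "card (insert e A) = Suc (dim S)"
    using A assms(7) span_base by force
  ultimately show ?thesis
    using basis_card_eq_dim by metis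
qed

text \<open>Otherwise \<open>u\<close>, \<open>e\<close> and a basis of \<open>S\<close> would be
  \<open>dim U + 1\<close> independent vectors in \<open>U\<close>.\<close>

lemma hyperplane_complement:
  assumes "subspace S" "subspace U" "S \<subseteq> U" "U \<subseteq> span T" "finite T"
    and "dim U = Suc (dim S)" "e \<in> U" "e \<notin> S" "u \<in> U"
  shows "\<exists>c. u - scale c e \<in> S"
proof (rule ccontr)
  assume no: "\<not> (\<exists>c. u - scale c e \<in> S)"
  obtain A where A: "finite A" "A \<subseteq> S" "independent A" "span A = S" "card A = dim S"
    using finite_basis_of_subspace[OF assms(1) _ assms(5)] assms(3,4) by blast
  obtain C where C: "finite C" "C \<subseteq> U" "independent C" "span C = U" "card C = dim U"
    using finite_basis_of_subspace[OF assms(2,4,5)] by blast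
  have 1: "independent (insert e A)"
    using A assms(8) independent_insertI by metis
  have u: "u \<notin> span (insert e A)"
    using no A(4) by (simp add: span_insert)
  then have "independent (insert u (insert e A))"
    using 1 independent_insertI by blast
  moreover have "insert u (insert e A) \<subseteq> span C"
    using A(2) assms(3,7,9) C(4) by blast
  ultimately have "card (insert u (insert e A)) \<le> card C"
    using independent_span_bound[OF C(1)] by blast
  moreover have "e \<notin> A" "u \<notin> insert e A"
    using A(2) assms(8) u span_base by blast+
  ultimately show False
    using A C assms(6) by simp
qed

lemma dim_zero_subspace:
  assumes "subspace S" "S \<subseteq> span T" "finite T" "dim S = 0"
  shows "S = {0}"
proof -
  obtain A where "finite A" "span A = S" "card A = dim S"
    using finite_basis_of_subspace[OF assms(1-3)] by blast
  then show ?thesis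
    using assms(4) by auto
qed

end

section \<open>Maps and forms that are linear on a subspace only\<close>

lemma linear_fromD:
  assumes "linear_from s t S f" "vector_space s" "vector_space t" "module.subspace s S"
  shows "x \<in> S \<Longrightarrow> y \<in> S \<Longrightarrow> f (x + y) = f x + f y"
    and "x \<in> S \<Longrightarrow> f (s c x) = t c (f x)"
    and "f 0 = 0"
    and "x \<in> S \<Longrightarrow> f (- x) = - f x"
    and "x \<in> S \<Longrightarrow> y \<in> S \<Longrightarrow> f (x - y) = f x - f y"
proof -
  interpret s: vector_space s by fact
  interpret t: vector_space t by fact
  show add: "f (x + y) = f x + f y" if "x \<in> S" "y \<in> S" for x y
    using assms(1) that by (simp add: linear_from_def)
  show scale: "f (s c x) = t c (f x)" if "x \<in> S" for c x
    using assms(1) that by (simp add: linear_from_def)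
  have 0: "0 \<in> S"
    using assms(4) s.subspace_0 by blast
  show "f 0 = 0"
    using scale[OF 0, of 0] by simp
  show minus: "f (- x) = - f x" if "x \<in> S" for x
    using scale[OF that, of "- 1"] by simp
  show "f (x - y) = f x - f y" if "x \<in> S" "y \<in> S" for x y
    using add[OF that(1) s.subspace_neg[OF assms(4) that(2)]] minus that by simp
qed

lemma bilinear_fromD:
  assumes "bilinear_from s t S f" "vector_space s" "vector_space t" "module.subspace s S" "z \<in> S"
  shows "x \<in> S \<Longrightarrow> y \<in> S \<Longrightarrow> f z (x + y) = f z x + f z y"
    and "x \<in> S \<Longrightarrow> f z (s c x) = t c (f z x)"
    and "f z 0 = 0"
    and "x \<in> S \<Longrightarrow> f z (- x) = - f z x"
    and "x \<in> S \<Longrightarrow> y \<in> S \<Longrightarrow> f z (x - y) = f z x - f z y"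
    and "x \<in> S \<Longrightarrow> y \<in> S \<Longrightarrow> f (x + y) z = f x z + f y z"
    and "x \<in> S \<Longrightarrow> f (s c x) z = t c (f x z)"
    and "f 0 z = 0"
    and "x \<in> S \<Longrightarrow> f (- x) z = - f x z"
    and "x \<in> S \<Longrightarrow> y \<in> S \<Longrightarrow> f (x - y) z = f x z - f y z"
proof -
  have l: "linear_from s t S (f z)" and r: "linear_from s t S (\<lambda>x. f x z)"
    using assms(1,5) by (auto simp: bilinear_from_def)
  note L = linear_fromD[OF l assms(2-4)] and R = linear_fromD[OF r assms(2-4)]
  show "x \<in> S \<Longrightarrow> y \<in> S \<Longrightarrow> f z (x + y) = f z x + f z y"
    and "x \<in> S \<Longrightarrow> f z (s c x) = t c (f z x)"
    and "f z 0 = 0"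
    and "x \<in> S \<Longrightarrow> f z (- x) = - f z x"
    and "x \<in> S \<Longrightarrow> y \<in> S \<Longrightarrow> f z (x - y) = f z x - f z y"
    and "x \<in> S \<Longrightarrow> y \<in> S \<Longrightarrow> f (x + y) z = f x z + f y z"
    and "x \<in> S \<Longrightarrow> f (s c x) z = t c (f x z)"
    and "f 0 z = 0"
    and "x \<in> S \<Longrightarrow> f (- x) z = - f x z"
    and "x \<in> S \<Longrightarrow> y \<in> S \<Longrightarrow> f (x - y) z = f x z - f y z"
    using L R by auto
qed

lemma vector_space_mult: "vector_space ((*) :: 'k::field \<Rightarrow> 'k \<Rightarrow> 'k)"
  by unfold_locales (simp_all add: algebra_simps)

text \<open>The map from \<open>S\<close> to its dual induced by \<open>F\<close> is injective by
  nondegeneracy, hence onto in finite dimension. \<open>F\<close> is an arbitrary bilinear form, so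
  that both the quadratic and the symplectic form are covered.\<close>

lemma riesz_representation:
  fixes s :: "'k::field \<Rightarrow> 'a::ab_group_add \<Rightarrow> 'a"
  assumes "vector_space s" "module.subspace s S" "S \<subseteq> module.span s T" "finite T"
    and F: "bilinear_from s (*) S F" and nondeg: "\<And>x. x \<in> S \<Longrightarrow> (\<And>y. y \<in> S \<Longrightarrow> F x y = 0) \<Longrightarrow> x = 0"
    and f: "linear_from s (*) S f"
  shows "\<exists>z\<in>S. \<forall>y\<in>S. f y = F z y"
proof -
  interpret vector_space s by fact
  interpret vector_space_pair s s ..
  obtain A where A: "finite A" "A \<subseteq> S" "independent A" "span A = S" "card A = dim S"
    using finite_basis_of_subspace[OF assms(2-4)] by blast
  have SA: "a \<in> S" if "a \<in> A" for a
    using A(2) that by blast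
  note Fd = bilinear_fromD[OF F assms(1) vector_space_mult assms(2)]
  \<comment> \<open>\<open>K x\<close> has the values \<open>F x b\<close> as its coordinates in the
    basis \<open>A\<close>; this replaces the dual space by \<open>S\<close> itself.\<close>
  define K where "K x = (\<Sum>b\<in>A. s (F x b) b)" for x
  have K_lin: "K (x + y) = K x + K y" "K (s c x) = s c (K x)" if "x \<in> S" "y \<in> S" for x y c
    unfolding K_def using that
    by (simp_all add: Fd SA scale_left_distrib sum.distrib scale_sum_right)
  \<comment> \<open>\<open>K\<close> is known to be linear on \<open>S\<close> only, whereas the
    library facts on images of independent sets and spans ask for a total linear map;
    \<open>M\<close> extends \<open>K\<close> from the basis.\<close>
  define M where "M = construct A K"
  have M: "Vector_Spaces.linear s s M"
    unfolding M_def using linear_construct A(3) by blast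
  have K_lin': "linear_from s s S K"
    using K_lin subspace_0[OF assms(2)] by (auto simp: linear_from_def)
  have K_coeff: "F x b = F y b" if "K x = K y" "b \<in> A" for x y b
  proof -
    have "(\<Sum>b\<in>A. s (F x b - F y b) b) = 0"
      using that(1) by (simp add: K_def scale_left_diff_distrib sum_subtractf)
    then show ?thesis
      using A(1,3) that(2) unfolding dependent_finite[OF A(1)] by force
  qed
  \<comment> \<open>Linear maps agreeing on \<open>A\<close> agree on \<open>S\<close>. The codomain
    is left open, since this is used for scalars and for vectors.\<close>
  have eqA: "g y = h y" if "\<And>b. b \<in> A \<Longrightarrow> g b = h b" "linear_from s t S g" "linear_from s t S h" "y \<in> S"
    and t: "vector_space t"
    for g h and t :: "'k \<Rightarrow> 'b::ab_group_add \<Rightarrow> 'b" and y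
  proof -
    note gd = linear_fromD[OF that(2) assms(1) t assms(2)]
      and hd = linear_fromD[OF that(3) assms(1) t assms(2)]
    have "y \<in> span A"
      using that(4) A(4) by blast
    then have "y \<in> S \<and> g y = h y"
    proof (induction rule: span_induct_alt)
      case base
      then show ?case
        using gd hd subspace_0[OF assms(2)] by simp
    next
      case (step c x y)
      then show ?case
        using SA[of x] that(1)[of x] assms(2) by (simp add: gd hd subspace_add subspace_scale)
    qed
    then show ?thesis ..
  qed
  have inj: "inj_on K S"
  proof (rule inj_onI)
    fix x y assume xy: "x \<in> S" "y \<in> S" and "K x = K y"
    then have "F x b = F y b" if "b \<in> A" for b
      using K_coeff that by blast
    then have "F x z = F y z" if "z \<in> S" for z
      by (rule eqA[OF _ _ _ that vector_space_mult])
        (use F xy in \<open>auto simp: bilinear_from_def\<close>)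
    then have "x - y = 0"
      using xy by (intro nondeg) (auto simp: Fd subspace_diff[OF assms(2)])
    then show "x = y" by simp
  qed
  have MK: "M x = K x" if "x \<in> S" for x
  proof (rule eqA[OF _ _ K_lin' that assms(1)])
    show "M b = K b" if "b \<in> A" for b
      using that A(3) by (simp add: M_def construct_basis)
    show "linear_from s s S M"
      by (simp add: linear_from_def linear_add[OF M] linear_scale[OF M])
  qed
  have M_inj: "inj_on M (span A)"
    using inj MK A(4) inj_on_cong[of S M K] by simp
  have "independent (M ` A)"
    using linear_independent_injective_image[OF M A(3) M_inj] .
  moreover have "M ` A \<subseteq> span A"
  proof -
    have "K x \<in> span A" for x
      unfolding K_def by (intro span_sum span_scale span_base)
    then show ?thesis using MK SA by auto
  qed
  moreover have card: "card (M ` A) = card A"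
    using M_inj by (intro card_image) (meson inj_on_subset span_superset)
  \<comment> \<open>The image of \<open>A\<close> consists of \<open>card A\<close> independent
    vectors in \<open>span A\<close>; a vector outside its span could be added, against the bound on
    independent sets.\<close>
  ultimately have "span A \<subseteq> span (M ` A)"
  proof -
    assume i: "independent (M ` A)" and s: "M ` A \<subseteq> span A"
    show ?thesis
    proof (rule subsetI, rule ccontr)
      fix x assume "x \<in> span A" "x \<notin> span (M ` A)"
      then have "independent (insert x (M ` A))" "insert x (M ` A) \<subseteq> span A"
        using i s independent_insertI by auto
      then have "card (insert x (M ` A)) \<le> card A"
        using independent_span_bound[OF A(1)] by blast
      moreover have "x \<notin> M ` A"
        using \<open>x \<notin> span (M ` A)\<close> span_base by blast
      ultimately show False
        using card A(1) by simp
    qed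
  qed
  also have "span (M ` A) = M ` span A"
    using linear_span_image[OF M] by simp
  finally have surj: "S \<subseteq> K ` S"
    using A(4) MK by auto
  have "(\<Sum>b\<in>A. s (f b) b) \<in> S"
    using SA by (intro subspace_sum subspace_scale assms(2)) auto
  then obtain z where z: "z \<in> S" "K z = (\<Sum>b\<in>A. s (f b) b)"
    using surj by force
  have "f b = F z b" if "b \<in> A" for b
  proof -
    have "(\<Sum>b\<in>A. s (f b - F z b) b) = 0"
      using z(2) by (simp add: K_def scale_left_diff_distrib sum_subtractf)
    then show ?thesis
      using A(1,3) that unfolding dependent_finite[OF A(1)] by force
  qed
  then have "f y = F z y" if "y \<in> S" for y
    by (rule eqA[OF _ f _ that vector_space_mult])
      (use F z(1) in \<open>auto simp: bilinear_from_def\<close>)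
  then show ?thesis
    using z(1) by blast
qed

section \<open>Quadratic Lie superalgebras\<close>

lemma psign_simps [simp]: "psign 0 = 1" "psign 1 = - 1"
  by (simp_all add: psign_def)

lemma psign_square [simp]: "psign d * psign d = 1" "psign d * (psign d * k) = k"
  by (simp_all add: psign_def)

locale lie_super =
  fixes L :: "('k::field_char_0, 'a::ab_group_add) superalgebra"
  assumes lie: "lie_superalgebra L"

sublocale lie_super \<subseteq> vector_space "scl L"
  using lie unfolding lie_superalgebra_def by blast

context lie_super
begin

lemma grade_subspace: "subspace (grade L i)"
  using lie unfolding lie_superalgebra_def by blast

lemma grade_inter: "grade L 0 \<inter> grade L 1 = {0}"
  using lie unfolding lie_superalgebra_def by blast

lemma grade_closed [simp]:
  shows "0 \<in> grade L i"
    and "X \<in> grade L i \<Longrightarrow> Y \<in> grade L i \<Longrightarrow> X + Y \<in> grade L i"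
    and "X \<in> grade L i \<Longrightarrow> Y \<in> grade L i \<Longrightarrow> X - Y \<in> grade L i"
    and "X \<in> grade L i \<Longrightarrow> - X \<in> grade L i"
    and "X \<in> grade L i \<Longrightarrow> scl L c X \<in> grade L i"
  using grade_subspace[of i]
  by (simp_all add: subspace_0 subspace_add subspace_diff subspace_neg subspace_scale)

lemma carr_subspace: "subspace (carr L)"
  unfolding carr_def by (intro subspace_sums grade_subspace)

lemma carr_closed [simp]:
  shows "0 \<in> carr L"
    and "X \<in> carr L \<Longrightarrow> Y \<in> carr L \<Longrightarrow> X + Y \<in> carr L"
    and "X \<in> carr L \<Longrightarrow> Y \<in> carr L \<Longrightarrow> X - Y \<in> carr L"
    and "X \<in> carr L \<Longrightarrow> - X \<in> carr L"
    and "X \<in> carr L \<Longrightarrow> scl L c X \<in> carr L"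
  using carr_subspace
  by (simp_all add: subspace_0 subspace_add subspace_diff subspace_neg subspace_scale)

lemma grade_carr [simp]: "X \<in> grade L i \<Longrightarrow> X \<in> carr L"
  by (cases i) (force simp: carr_def)+

lemma grade_decomp_unique:
  assumes "X0 \<in> grade L 0" "Y0 \<in> grade L 0" "X1 \<in> grade L 1" "Y1 \<in> grade L 1" "X0 + X1 = Y0 + Y1"
  shows "X0 = Y0" "X1 = Y1"
proof -
  have "X0 - Y0 = Y1 - X1"
    using assms(5) by (simp add: algebra_simps)
  then have "X0 - Y0 \<in> grade L 0 \<inter> grade L 1"
    using assms(1-4) by (metis IntI grade_closed(3))
  then show "X0 = Y0" "X1 = Y1"
    using grade_inter assms(5) by auto
qed

lemma parity_aut_add:
  assumes "X0 \<in> grade L 0" "X1 \<in> grade L 1"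
  shows "parity_aut L (X0 + X1) = X0 - X1"
  unfolding parity_aut_def using assms grade_decomp_unique
  by (intro the_equality) (blast, metis)

lemma parity_aut_grade [simp]:
  shows "X \<in> grade L 0 \<Longrightarrow> parity_aut L X = X"
    and "X \<in> grade L 1 \<Longrightarrow> parity_aut L X = - X"
  using parity_aut_add[of X 0] parity_aut_add[of 0 X] by simp_all

lemma brk_bilinear: "bilinear_from (scl L) (scl L) (carr L) (brk L)"
  using lie unfolding lie_superalgebra_def by blast

lemmas brk_linear [simp] =
  bilinear_fromD[OF brk_bilinear vector_space_axioms vector_space_axioms carr_subspace]

lemma brk_grade: "X \<in> grade L i \<Longrightarrow> Y \<in> grade L j \<Longrightarrow> brk L X Y \<in> grade L (i + j)"
  using lie unfolding lie_superalgebra_def by blast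

lemma brk_grade' [simp]:
  shows "X \<in> grade L 0 \<Longrightarrow> Y \<in> grade L j \<Longrightarrow> brk L X Y \<in> grade L j"
    and "X \<in> grade L i \<Longrightarrow> Y \<in> grade L 0 \<Longrightarrow> brk L X Y \<in> grade L i"
    and "X \<in> grade L 1 \<Longrightarrow> Y \<in> grade L 1 \<Longrightarrow> brk L X Y \<in> grade L 0"
  using brk_grade[of X 0 Y j] brk_grade[of X i Y 0] brk_grade[of X 1 Y 1]
  by (cases i; cases j; simp)+

lemma carr_cases:
  assumes "X \<in> carr L"
  obtains X0 X1 where "X0 \<in> grade L 0" "X1 \<in> grade L 1" "X = X0 + X1"
  using assms by (auto simp: carr_def)

lemma brk_carr [simp]: "X \<in> carr L \<Longrightarrow> Y \<in> carr L \<Longrightarrow> brk L X Y \<in> carr L"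
  by (elim carr_cases) (simp add: grade_carr[OF brk_grade])

lemma brk_skew:
  "X \<in> grade L x \<Longrightarrow> Y \<in> grade L y \<Longrightarrow> brk L X Y = - scl L (psign (x * y)) (brk L Y X)"
  using lie unfolding lie_superalgebra_def by blast

lemma brk_skew_even:
  assumes "X \<in> grade L 0" "Y \<in> carr L"
  shows "brk L X Y = - brk L Y X"
proof -
  obtain Y0 Y1 where Y: "Y0 \<in> grade L 0" "Y1 \<in> grade L 1" "Y = Y0 + Y1"
    using assms(2) carr_cases by blast
  show ?thesis
    using brk_skew[OF assms(1) Y(1)] brk_skew[OF assms(1) Y(2)] assms(1) Y by simp
qed

text \<open>Against an odd \<open>U\<close> the sign of supersymmetry depends only on the degree of
  the other argument, so the grading automorphism absorbs it. The bracket of the generalized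
  extension is written in this form.\<close>

lemma brk_parity_aut:
  assumes "U \<in> grade L 1" "X \<in> carr L"
  shows "brk L X U = - brk L U (parity_aut L X)"
proof -
  obtain X0 X1 where X: "X0 \<in> grade L 0" "X1 \<in> grade L 1" "X = X0 + X1"
    using assms(2) carr_cases by blast
  have "brk L X0 U = - brk L U X0" "brk L X1 U = brk L U X1"
    using brk_skew[OF X(1) assms(1)] brk_skew[OF X(2) assms(1)] by simp_all
  then show ?thesis
    using X assms by (simp add: parity_aut_add)
qed

lemma jacobi:
  "\<lbrakk>X \<in> grade L x; Y \<in> grade L y; Z \<in> grade L z\<rbrakk> \<Longrightarrow>
    scl L (psign (x * z)) (brk L X (brk L Y Z)) + scl L (psign (x * y)) (brk L Y (brk L Z X))
    + scl L (psign (y * z)) (brk L Z (brk L X Y)) = 0"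
  using lie unfolding lie_superalgebra_def by blast

text \<open>The Jacobi identity, read as saying that bracketing with \<open>X\<close> is a
  superderivation of degree \<open>x\<close>. Splitting \<open>Z\<close> into its two components
  removes homogeneity from the last argument, as in the definition of a superderivation.\<close>

lemma leibniz:
  assumes X: "X \<in> grade L x" and Y: "Y \<in> grade L y" and "Z \<in> carr L"
  shows "brk L X (brk L Y Z) = brk L (brk L X Y) Z + scl L (psign (x * y)) (brk L Y (brk L X Z))"
proof -
  have hom: "brk L X (brk L Y Z) = brk L (brk L X Y) Z + scl L (psign (x * y)) (brk L Y (brk L X Z))"
    if Z: "Z \<in> grade L z" for z Z
  proof -
    have "brk L Z X = - scl L (psign (z * x)) (brk L X Z)"
      and "brk L Z (brk L X Y) = - scl L (psign (z * (x + y))) (brk L (brk L X Y) Z)"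
      using brk_skew[OF Z X] brk_skew[OF Z brk_grade[OF X Y]] by simp_all
    then show ?thesis
      using jacobi[OF X Y Z] X Y Z
      by (cases x; cases y; cases z) (simp_all add: algebra_simps eq_neg_iff_add_eq_0)
  qed
  obtain Z0 Z1 where "Z0 \<in> grade L 0" "Z1 \<in> grade L 1" "Z = Z0 + Z1"
    using assms(3) carr_cases by blast
  then show ?thesis
    using hom[of Z0 0] hom[of Z1 1] X Y by (simp add: scale_right_distrib)
qed

lemma finite_dimE:
  assumes "finite_dim L"
  obtains T where "finite T" "carr L = span T"
  using assms by (auto simp: finite_dim_def)

end

locale quadratic_super = lie_super L for L :: "('k::field_char_0, 'a::ab_group_add) superalgebra" +
  fixes B :: "'a \<Rightarrow> 'a \<Rightarrow> 'k"
  assumes quadratic: "quadratic L B"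
begin

lemma form_bilinear: "bilinear_from (scl L) (*) (carr L) B"
  using quadratic unfolding quadratic_def even_nondegenerate_form_def by blast

lemmas form_linear [simp] =
  bilinear_fromD[OF form_bilinear vector_space_axioms vector_space_mult carr_subspace]

lemma form_even [simp]: "X \<in> grade L 0 \<Longrightarrow> Y \<in> grade L 1 \<Longrightarrow> B X Y = 0"
  "X \<in> grade L 0 \<Longrightarrow> Y \<in> grade L 1 \<Longrightarrow> B Y X = 0"
  using quadratic unfolding quadratic_def even_nondegenerate_form_def by blast+

lemma form_nondegenerate: "X \<in> carr L \<Longrightarrow> (\<And>Y. Y \<in> carr L \<Longrightarrow> B X Y = 0) \<Longrightarrow> X = 0"
  using quadratic unfolding quadratic_def even_nondegenerate_form_def by blast

lemma form_sym: "X \<in> grade L x \<Longrightarrow> Y \<in> grade L y \<Longrightarrow> B X Y = psign (x * y) * B Y X"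
  using quadratic unfolding quadratic_def by blast

lemma form_invariant:
  "X \<in> carr L \<Longrightarrow> Y \<in> carr L \<Longrightarrow> Z \<in> carr L \<Longrightarrow> B (brk L X Y) Z = B X (brk L Y Z)"
  using quadratic unfolding quadratic_def by blast

lemma form_sym_even:
  assumes "X \<in> grade L 0" "Y \<in> carr L"
  shows "B X Y = B Y X"
proof -
  obtain Y0 Y1 where Y: "Y0 \<in> grade L 0" "Y1 \<in> grade L 1" "Y = Y0 + Y1"
    using assms(2) carr_cases by blast
  then show ?thesis
    using form_sym[OF assms(1) Y(1)] assms by simp
qed

lemma form_skew_odd:
  assumes "X \<in> grade L 1" "Y \<in> carr L"
  shows "B X Y = - B Y X"
proof -
  obtain Y0 Y1 where Y: "Y0 \<in> grade L 0" "Y1 \<in> grade L 1" "Y = Y0 + Y1"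
    using assms(2) carr_cases by blast
  then show ?thesis
    using form_sym[OF assms(1) Y(2)] assms by simp
qed

lemma form_odd_self [simp]: "X \<in> grade L 1 \<Longrightarrow> B X X = 0"
  using form_skew_odd[of X X] by simp

text \<open>Representing each functional \<open>\<omega> X\<close> through \<open>B\<close> defines
  \<delta>. Nondegeneracy of \<omega> makes it injective, representing each \<open>B Y\<close>
  through \<omega> makes it onto, and the cocycle condition becomes the derivation rule.\<close>

lemma represents_symplectic_exists:
  assumes "finite_dim L" "symplectic L \<omega>"
  obtains \<delta> where "represents_symplectic L B \<omega> \<delta>"
proof -
  obtain T where T: "finite T" "carr L = span T"
    using assms(1) by (rule finite_dimE)
  have \<omega>_bil: "bilinear_from (scl L) (*) (carr L) \<omega>"
    and \<omega>_even: "\<And>X Y. X \<in> grade L 0 \<Longrightarrow> Y \<in> grade L 1 \<Longrightarrow> \<omega> X Y = 0"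
      "\<And>X Y. X \<in> grade L 0 \<Longrightarrow> Y \<in> grade L 1 \<Longrightarrow> \<omega> Y X = 0"
    and \<omega>_nondeg: "\<And>X. X \<in> carr L \<Longrightarrow> (\<And>Y. Y \<in> carr L \<Longrightarrow> \<omega> X Y = 0) \<Longrightarrow> X = 0"
    and \<omega>_skew: "\<And>x y X Y. X \<in> grade L x \<Longrightarrow> Y \<in> grade L y \<Longrightarrow> \<omega> X Y = - psign (x * y) * \<omega> Y X"
    and \<omega>_cocycle: "\<And>x y z X Y Z. X \<in> grade L x \<Longrightarrow> Y \<in> grade L y \<Longrightarrow> Z \<in> grade L z \<Longrightarrow>
        psign (x * z) * \<omega> X (brk L Y Z) + psign (y * x) * \<omega> Y (brk L Z X)
        + psign (z * y) * \<omega> Z (brk L X Y) = 0"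
    using assms(2) unfolding symplectic_def even_nondegenerate_form_def by blast+
  note \<omega>_linear = bilinear_fromD[OF \<omega>_bil vector_space_axioms vector_space_mult carr_subspace]
  note riesz = riesz_representation[OF vector_space_axioms carr_subspace equalityD1[OF T(2)] T(1)]
  have "\<exists>Z\<in>carr L. \<forall>Y\<in>carr L. \<omega> X Y = B Z Y" if "X \<in> carr L" for X
    using riesz[OF form_bilinear form_nondegenerate, of "\<omega> X"] \<omega>_bil that
    by (auto simp: bilinear_from_def)
  then obtain \<delta> where \<delta> [simp]: "X \<in> carr L \<Longrightarrow> \<delta> X \<in> carr L"
    and \<omega>: "X \<in> carr L \<Longrightarrow> Y \<in> carr L \<Longrightarrow> \<omega> X Y = B (\<delta> X) Y" for X Y
    by metis
  \<comment> \<open>Every identity for \<delta> is checked by pairing both sides with homogeneous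
    vectors.\<close>
  have eqI: "X = Y" if "X \<in> carr L" "Y \<in> carr L"
    and "\<And>z Z. Z \<in> grade L z \<Longrightarrow> B X Z = B Y Z" for X Y
  proof -
    have "B (X - Y) Z = 0" if "Z \<in> carr L" for Z
    proof -
      obtain Z0 Z1 where "Z0 \<in> grade L 0" "Z1 \<in> grade L 1" "Z = Z0 + Z1"
        using \<open>Z \<in> carr L\<close> carr_cases by blast
      then show ?thesis
        using that \<open>X \<in> carr L\<close> \<open>Y \<in> carr L\<close>
          \<open>\<And>z Z. Z \<in> grade L z \<Longrightarrow> B X Z = B Y Z\<close>[of Z0 0]
          \<open>\<And>z Z. Z \<in> grade L z \<Longrightarrow> B X Z = B Y Z\<close>[of Z1 1] by simp
    qed
    then show ?thesis
      using form_nondegenerate[of "X - Y"] that(1,2) by simp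
  qed
  have lin: "linear_from (scl L) (scl L) (carr L) \<delta>"
    unfolding linear_from_def by (auto intro!: eqI simp: \<omega>[symmetric] \<omega>_linear)
  note \<delta>_linear [simp] = linear_fromD[OF lin vector_space_axioms vector_space_axioms carr_subspace]
  \<comment> \<open>Both forms are even, so the component of \<open>\<delta> X\<close> in the wrong
    degree is orthogonal to everything.\<close>
  have grade: "\<delta> X \<in> grade L i" if X: "X \<in> grade L i" for i X
  proof -
    obtain U0 U1 where U: "U0 \<in> grade L 0" "U1 \<in> grade L 1" "\<delta> X = U0 + U1"
      using carr_cases[of "\<delta> X"] X by (metis \<delta> grade_carr)
    show ?thesis
    proof (cases i)
      assume i: "i = 0"
      have "B U1 Y = 0" if "Y \<in> grade L z" for z Y
        using that X U i \<omega>[of X Y] \<omega>_even(1)[of X Y] by (cases z) simp_all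
      then have "U1 = 0"
        using U by (intro eqI) auto
      then show ?thesis using U i by simp
    next
      assume i: "i = 1"
      have "B U0 Y = 0" if "Y \<in> grade L z" for z Y
        using that X U i \<omega>[of X Y] \<omega>_even(2)[of Y X] by (cases z) simp_all
      then have "U0 = 0"
        using U by (intro eqI) auto
      then show ?thesis using U i by simp
    qed
  qed
  have skew_hom: "B (\<delta> X) Y = - B X (\<delta> Y)" if X: "X \<in> grade L x" and Y: "Y \<in> grade L y" for x y X Y
    using \<omega>_skew[OF X Y] form_sym[OF grade[OF Y] X] X Y
    by (simp add: \<omega> mult.commute)
  have skew: "B (\<delta> X) Y = - B X (\<delta> Y)" if X: "X \<in> grade L x" and Y: "Y \<in> carr L" for x X Y
  proof -
    obtain Y0 Y1 where "Y0 \<in> grade L 0" "Y1 \<in> grade L 1" "Y = Y0 + Y1"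
      using Y carr_cases by blast
    then show ?thesis
      using skew_hom[OF X, of Y0 0] skew_hom[OF X, of Y1 1] X by simp
  qed
  have der_hom: "\<delta> (brk L X Y) = brk L (\<delta> X) Y + brk L X (\<delta> Y)"
    if X: "X \<in> grade L x" and Y: "Y \<in> grade L y" for x y X Y
  proof (rule eqI)
    fix z Z assume Z: "Z \<in> grade L z"
    \<comment> \<open>Paired with \<open>Z\<close>, the three terms of the derivation rule are, up
      to sign, the three terms of the cocycle condition; the rest is bookkeeping of signs.\<close>
    have "B (\<delta> (brk L X Y)) Z = - psign ((x + y) * z) * \<omega> Z (brk L X Y)"
      using \<omega>_skew[OF brk_grade[OF X Y] Z] X Y Z by (simp add: \<omega>)
    moreover have "B (brk L (\<delta> X) Y) Z = \<omega> X (brk L Y Z)"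
      using X Y Z by (simp add: \<omega> form_invariant)
    moreover have "B (brk L X (\<delta> Y)) Z = psign (x * y) * psign (x * z) * \<omega> Y (brk L Z X)"
      using brk_skew[OF X grade[OF Y]] brk_skew[OF X Z] X Y Z
      by (simp add: \<omega> form_invariant)
    moreover have "psign ((x + y) * z) = (psign (x * z) * psign (z * y) :: 'k)"
      by (cases x; cases y; cases z) simp_all
    moreover have "psign (x * z) * psign (x * z) = (1 :: 'k)" "psign (y * x) = (psign (x * y) :: 'k)"
      by (simp_all add: mult.commute)
    ultimately have "B (\<delta> (brk L X Y)) Z = B (brk L (\<delta> X) Y) Z + B (brk L X (\<delta> Y)) Z"
      using \<omega>_cocycle[OF X Y Z] by algebra
    then show "B (\<delta> (brk L X Y)) Z = B (brk L (\<delta> X) Y + brk L X (\<delta> Y)) Z"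
      using X Y Z by simp
  qed (use X Y in simp_all)
  have der: "\<delta> (brk L X Y) = brk L (\<delta> X) Y + brk L X (\<delta> Y)"
    if X: "X \<in> grade L x" and Y: "Y \<in> carr L" for x X Y
  proof -
    obtain Y0 Y1 where "Y0 \<in> grade L 0" "Y1 \<in> grade L 1" "Y = Y0 + Y1"
      using Y carr_cases by blast
    then show ?thesis
      using der_hom[OF X, of Y0 0] der_hom[OF X, of Y1 1] X by simp
  qed
  have "bij_betw \<delta> (carr L) (carr L)"
  proof (rule bij_betw_imageI)
    show "inj_on \<delta> (carr L)"
    proof (rule inj_onI)
      fix X Y assume XY: "X \<in> carr L" "Y \<in> carr L" "\<delta> X = \<delta> Y"
      then have "\<omega> (X - Y) Z = 0" if "Z \<in> carr L" for Z
        using that by (simp add: \<omega>)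
      then show "X = Y"
        using \<omega>_nondeg[of "X - Y"] XY by simp
    qed
    show "\<delta> ` carr L = carr L"
    proof
      show "carr L \<subseteq> \<delta> ` carr L"
      proof
        fix Y assume Y: "Y \<in> carr L"
        then obtain X where X: "X \<in> carr L" "\<forall>Z\<in>carr L. B Y Z = \<omega> X Z"
          using riesz[OF \<omega>_bil \<omega>_nondeg, of "B Y"] form_bilinear
          by (auto simp: bilinear_from_def)
        then have "Y = \<delta> X"
          using Y by (intro eqI) (auto simp: \<omega>)
        then show "Y \<in> \<delta> ` carr L" using X by blast
      qed
    qed auto
  qed
  then have "represents_symplectic L B \<omega> \<delta>"
    using lin grade skew der \<omega>
    by (auto simp: represents_symplectic_def skew_superderivation_def superderivation_def)
  then show thesis ..
qed

end

section \<open>Reduction by a central isotropic odd vector\<close>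

text \<open>The data needed for the reduction, kept free of any flag: odd vectors are isotropic, so
  \<open>e\<close> and \<open>f\<close> span a hyperbolic plane, and the line of \<open>f\<close> is
  central and stable under \<delta>. The vector \<open>e\<close> may later be exchanged for another
  one with the same \<open>f\<close>.\<close>

locale odd_hyperbolic_pair = quadratic_super L B
  for L :: "('k::field_char_0, 'a::ab_group_add) superalgebra" and B :: "'a \<Rightarrow> 'a \<Rightarrow> 'k" +
  fixes \<omega> :: "'a \<Rightarrow> 'a \<Rightarrow> 'k" and \<delta> :: "'a \<Rightarrow> 'a" and e f :: 'a and \<alpha> :: 'k
  assumes symplectic: "symplectic L \<omega>"
    and represents: "represents_symplectic L B \<omega> \<delta>"
    and e [simp]: "e \<in> grade L 1"
    and f [simp]: "f \<in> grade L 1"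
    and form_f_e [simp]: "B f e = 1"
    and central [simp]: "X \<in> carr L \<Longrightarrow> brk L f X = 0"
    and eigen [simp]: "\<delta> f = scl L \<alpha> f"
begin

lemma ef_carr [simp]: "e \<in> carr L" "f \<in> carr L"
  using grade_carr[OF e] grade_carr[OF f] .

lemma form_e_f [simp]: "B e f = - 1"
  using form_skew_odd[of e f] by simp

lemma parity_aut_carr [simp]: "X \<in> carr L \<Longrightarrow> parity_aut L X \<in> carr L"
  by (elim carr_cases) (simp add: parity_aut_add)

lemma central' [simp]: "X \<in> carr L \<Longrightarrow> brk L X f = 0"
  using brk_parity_aut[OF f, of X] by simp

lemma \<delta>_skew_superderivation: "skew_superderivation L B 0 \<delta>"
  using represents unfolding represents_symplectic_def by blast

lemma \<delta>_linear_from: "linear_from (scl L) (scl L) (carr L) \<delta>"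
  using \<delta>_skew_superderivation unfolding skew_superderivation_def superderivation_def by blast

lemmas \<delta>_linear [simp] =
  linear_fromD[OF \<delta>_linear_from vector_space_axioms vector_space_axioms carr_subspace]

lemma \<delta>_grade [simp]: "X \<in> grade L i \<Longrightarrow> \<delta> X \<in> grade L i"
  using \<delta>_skew_superderivation unfolding skew_superderivation_def superderivation_def
  by (metis add_0_left image_subset_iff)

lemma \<delta>_bij: "bij_betw \<delta> (carr L) (carr L)"
  using represents unfolding represents_symplectic_def by blast

lemma \<delta>_carr [simp]: "X \<in> carr L \<Longrightarrow> \<delta> X \<in> carr L"
  using \<delta>_bij by (auto simp: bij_betw_def)

lemma symplectic_form: "X \<in> carr L \<Longrightarrow> Y \<in> carr L \<Longrightarrow> \<omega> X Y = B (\<delta> X) Y"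
  using represents unfolding represents_symplectic_def by blast

lemma \<delta>_brk:
  assumes "X \<in> carr L" "Y \<in> carr L"
  shows "\<delta> (brk L X Y) = brk L (\<delta> X) Y + brk L X (\<delta> Y)"
proof -
  have hom: "\<delta> (brk L X Y) = brk L (\<delta> X) Y + brk L X (\<delta> Y)" if "X \<in> grade L x" for x X
    using \<delta>_skew_superderivation that assms(2)
    unfolding skew_superderivation_def superderivation_def by simp
  obtain X0 X1 where "X0 \<in> grade L 0" "X1 \<in> grade L 1" "X = X0 + X1"
    using assms(1) carr_cases by blast
  then show ?thesis
    using hom[of X0 0] hom[of X1 1] assms(2) by simp
qed

lemma \<delta>_skew:
  assumes "X \<in> carr L" "Y \<in> carr L"
  shows "B (\<delta> X) Y = - B X (\<delta> Y)"
proof -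
  have hom: "B (\<delta> X) Y = - B X (\<delta> Y)" if "X \<in> grade L x" for x X
    using \<delta>_skew_superderivation that assms(2) unfolding skew_superderivation_def by simp
  obtain X0 X1 where "X0 \<in> grade L 0" "X1 \<in> grade L 1" "X = X0 + X1"
    using assms(1) carr_cases by blast
  then show ?thesis
    using hom[of X0 0] hom[of X1 1] assms(2) by simp
qed

lemma \<alpha>_nonzero: "\<alpha> \<noteq> 0"
proof
  assume "\<alpha> = 0"
  then have "\<delta> f = \<delta> 0" by simp
  then have "f = 0"
    using \<delta>_bij by (metis bij_betw_def carr_closed(1) ef_carr(2) inj_onD)
  then show False
    using form_f_e by simp
qed

text \<open>The orthogonal projection along the plane spanned by \<open>e\<close> and \<open>f\<close>; recall
  \<open>B(f, e) = 1 = - B(e, f)\<close>.\<close>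

definition proj :: "'a \<Rightarrow> 'a" where
  "proj X = X - scl L (B f X) e - scl L (B X e) f"

text \<open>The reduction \<open>f\<^sup>\<bottom> / \<K>f\<close> by the central isotropic line, realised inside \<open>L\<close>.\<close>

definition H :: "('k, 'a) superalgebra" where
  "H = \<lparr>scl = scl L, grade = \<lambda>i. {X \<in> grade L i. B f X = 0 \<and> B e X = 0},
        brk = \<lambda>X Y. proj (brk L X Y)\<rparr>"

definition D :: "'a \<Rightarrow> 'a" where "D X = proj (brk L e X)"

abbreviation X0 :: 'a where "X0 \<equiv> brk L e e"

definition A1 :: 'a where "A1 = proj (\<delta> e)"

text \<open>Since \<open>B f e = 1\<close> and \<open>e\<close> is isotropic, pairing with
  \<open>e\<close> on the right reads off the coefficient of \<open>f\<close>.\<close>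

definition \<mu> :: 'k where "\<mu> = B (\<delta> e) e"

definition \<delta>H :: "'a \<Rightarrow> 'a" where "\<delta>H X = proj (\<delta> X)"

lemma H_simps [simp]: "scl H = scl L" "brk H X Y = proj (brk L X Y)"
  by (simp_all add: H_def)

lemma H_grade: "X \<in> grade H i \<longleftrightarrow> X \<in> grade L i \<and> B f X = 0 \<and> B e X = 0"
  by (simp add: H_def)

lemma H_carr: "X \<in> carr H \<longleftrightarrow> X \<in> carr L \<and> B f X = 0 \<and> B e X = 0"
proof
  assume "X \<in> carr H"
  then show "X \<in> carr L \<and> B f X = 0 \<and> B e X = 0"
    by (auto simp: carr_def[of H] H_grade)
next
  assume X: "X \<in> carr L \<and> B f X = 0 \<and> B e X = 0"
  then obtain Y0 Y1 where "Y0 \<in> grade L 0" "Y1 \<in> grade L 1" "X = Y0 + Y1"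
    using carr_cases by blast
  then show "X \<in> carr H"
    using X by (fastforce simp: carr_def[of H] H_grade)
qed

lemma H_carr_simps [simp]:
  assumes "X \<in> carr H"
  shows "X \<in> carr L" "B f X = 0" "B e X = 0" "B X f = 0" "B X e = 0"
proof -
  show X: "X \<in> carr L" "B f X = 0" "B e X = 0"
    using assms by (simp_all add: H_carr)
  show "B X f = 0" "B X e = 0"
    using form_skew_odd[OF f X(1)] form_skew_odd[OF e X(1)] X by simp_all
qed

lemma H_grade_simps [simp]: "X \<in> grade H i \<Longrightarrow> X \<in> grade L i"
  "X \<in> grade H i \<Longrightarrow> X \<in> carr H"
  using H_carr grade_carr[of X i] unfolding H_grade by blast+

text \<open>Orthogonality to the odd vectors \<open>e\<close> and \<open>f\<close> is automatic for
  even vectors, so the reduction shrinks only the odd part.\<close>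

lemma H_grade_0: "grade H 0 = grade L 0"
  by (auto simp: H_grade simp del: H_grade_simps)

lemma even_carr_H [simp]: "X \<in> grade L 0 \<Longrightarrow> X \<in> carr H"
  using H_grade_0 H_grade_simps(2) by blast

lemma proj_linear [simp]:
  assumes "X \<in> carr L"
  shows "Y \<in> carr L \<Longrightarrow> proj (X + Y) = proj X + proj Y"
    and "Y \<in> carr L \<Longrightarrow> proj (X - Y) = proj X - proj Y"
    and "proj (scl L c X) = scl L c (proj X)"
    and "proj (- X) = - proj X"
  using assms by (simp_all add: proj_def algebra_simps)

lemma proj_simps [simp]: "proj 0 = 0" "proj e = 0" "proj f = 0"
  by (simp_all add: proj_def)

lemma proj_carr [simp]: "X \<in> carr L \<Longrightarrow> proj X \<in> carr H"
  using form_skew_odd[OF e, of X] by (simp add: H_carr proj_def del: H_carr_simps)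

lemma proj_id [simp]: "X \<in> carr H \<Longrightarrow> proj X = X"
  by (simp add: proj_def)

lemma proj_even [simp]: "X \<in> grade L 0 \<Longrightarrow> proj X = X"
  by simp

lemma proj_grade [simp]: "X \<in> grade L i \<Longrightarrow> proj X \<in> grade H i"
proof -
  assume X: "X \<in> grade L i"
  have "proj X \<in> grade L i"
    using X by (cases i) (simp_all add: proj_def)
  moreover have "proj X \<in> carr H"
    using X by simp
  ultimately show ?thesis
    unfolding H_grade by simp
qed

lemma proj_form [simp]:
  assumes "X \<in> carr L" "Y \<in> carr H"
  shows "B (proj X) Y = B X Y" "B Y (proj X) = B Y X"
  using assms by (simp_all add: proj_def)

text \<open>As \<open>f\<close> is central, invariance puts all brackets into the orthogonal of
  \<open>f\<close>. There \<open>proj\<close> only subtracts a multiple of \<open>f\<close>.\<close>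

lemma form_f_brk [simp]: "X \<in> carr L \<Longrightarrow> Y \<in> carr L \<Longrightarrow> B f (brk L X Y) = 0"
  using form_invariant[of f X Y] by simp

lemma form_f_\<delta> [simp]: "X \<in> carr L \<Longrightarrow> B f X = 0 \<Longrightarrow> B f (\<delta> X) = 0"
  using \<delta>_skew[of f X] by simp

text \<open>On the orthogonal of \<open>f\<close> the projection changes \<open>Y\<close> by a
  central vector. Inner projections therefore disappear from iterated brackets, and the identities
  of \<open>L\<close> pass to \<open>H\<close>.\<close>

lemma brk_proj [simp]:
  assumes "X \<in> carr L" "Y \<in> carr L" "B f Y = 0"
  shows "brk L X (proj Y) = brk L X Y" "brk L (proj Y) X = brk L Y X"
  using assms by (simp_all add: proj_def)

lemma proj_\<delta>_proj [simp]: "X \<in> carr L \<Longrightarrow> B f X = 0 \<Longrightarrow> proj (\<delta> (proj X)) = proj (\<delta> X)"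
  by (simp add: proj_def[of X])

section \<open>The reduced algebra is quadratic symplectic\<close>

lemma H_subspace: "subspace (grade H i)"
  by (auto simp: subspace_def H_grade simp del: H_grade_simps)

lemma H_carr_subspace: "subspace (carr H)"
  by (auto simp: subspace_def H_carr simp del: H_carr_simps)

lemma H_lie_superalgebra: "lie_superalgebra H"
  unfolding lie_superalgebra_def
proof (intro conjI allI ballI)
  show "vector_space (scl H)"
    using vector_space_axioms by simp
  show "module.subspace (scl H) (grade H i)" for i
    using H_subspace by simp
  show "grade H 0 \<inter> grade H 1 = {0}"
    using grade_inter H_grade_simps(1) subspace_0[OF H_subspace] by blast
  show "bilinear_from (scl H) (scl H) (carr H) (brk H)"
    by (simp add: bilinear_from_def linear_from_def)
next
  fix i j X Y assume "X \<in> grade H i" "Y \<in> grade H j"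
  then have *: "X \<in> grade L i" "Y \<in> grade L j"
    by auto
  show "brk H X Y \<in> grade H (i + j)"
    unfolding H_simps by (intro proj_grade brk_grade *)
  show "brk H X Y = - scl H (psign (i * j)) (brk H Y X)"
    using * brk_skew[OF *] grade_carr[OF *(1)] grade_carr[OF *(2)] by simp
next
  fix x y z X Y Z assume "X \<in> grade H x" "Y \<in> grade H y" "Z \<in> grade H z"
  then have *: "X \<in> grade L x" "Y \<in> grade L y" "Z \<in> grade L z" "X \<in> carr L" "Y \<in> carr L" "Z \<in> carr L"
    by auto
  then show "scl H (psign (x * z)) (brk H X (brk H Y Z)) + scl H (psign (x * y)) (brk H Y (brk H Z X))
    + scl H (psign (y * z)) (brk H Z (brk H X Y)) = 0"
    \<comment> \<open>The projection of the Jacobi identity of \<open>L\<close>; simplification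
      removes the inner projections.\<close>
    using arg_cong[OF jacobi[OF *(1-3)], of proj] by simp
qed

lemma H_quadratic: "quadratic H B"
  unfolding quadratic_def even_nondegenerate_form_def
proof (intro conjI allI ballI impI)
  show "lie_superalgebra H"
    by (rule H_lie_superalgebra)
  show "bilinear_from (scl H) (*) (carr H) B"
    by (simp add: bilinear_from_def linear_from_def)
next
  fix X Y assume "X \<in> grade H 0" "Y \<in> grade H 1"
  then show "B X Y = 0" "B Y X = 0"
    by (auto simp: H_grade simp del: H_grade_simps)
next
  fix X assume X: "X \<in> carr H" "\<forall>Y\<in>carr H. B X Y = 0"
  have "B X Y = 0" if "Y \<in> carr L" for Y
    using bspec[OF X(2) proj_carr[OF that]] X(1) that by simp
  then show "X = 0"
    using form_nondegenerate[of X] X by simp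
next
  fix x y X Y assume "X \<in> grade H x" "Y \<in> grade H y"
  then show "B X Y = psign (x * y) * B Y X"
    using form_sym[of X x Y y] by simp
next
  fix X Y Z assume "X \<in> carr H" "Y \<in> carr H" "Z \<in> carr H"
  then show "B (brk H X Y) Z = B X (brk H Y Z)"
    using form_invariant[of X Y Z] by simp
qed

lemma H_lie_super: "lie_super H"
  by unfold_locales (rule H_lie_superalgebra)

text \<open>If \<open>\<delta>H X = 0\<close>, then \<open>\<delta> X\<close> is a multiple of
  \<open>f\<close>, hence so is \<open>X\<close>, as \<delta> is injective and scales
  \<open>f\<close> by a nonzero \<alpha>; but \<open>f\<close> is not in \<open>H\<close>.
  Conversely, a preimage under \<delta> of a vector of \<open>H\<close> is orthogonal to
  \<open>f\<close>, so it may be projected.\<close>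

lemma \<delta>H_bij: "bij_betw \<delta>H (carr H) (carr H)"
proof (rule bij_betw_imageI)
  have ker: "X = 0" if "X \<in> carr H" "\<delta>H X = 0" for X
  proof -
    have "\<delta> X = scl L (B (\<delta> X) e) f"
      using that by (simp add: \<delta>H_def proj_def)
    also have "\<dots> = \<delta> (scl L (B (\<delta> X) e / \<alpha>) f)"
      using \<alpha>_nonzero by simp
    finally have "X = scl L (B (\<delta> X) e / \<alpha>) f"
      using \<delta>_bij that(1) by (metis H_carr_simps(1) bij_betw_def carr_closed(5) ef_carr(2) inj_onD)
    then have "X = proj (scl L (B (\<delta> X) e / \<alpha>) f)"
      using that(1) proj_id by metis
    then show "X = 0" by simp
  qed
  show "inj_on \<delta>H (carr H)"
  proof (rule inj_onI)
    fix X Y assume "X \<in> carr H" "Y \<in> carr H" "\<delta>H X = \<delta>H Y"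
    then show "X = Y"
      using ker[of "X - Y"] subspace_diff[OF H_carr_subspace, of X Y] by (simp add: \<delta>H_def)
  qed
  show "\<delta>H ` carr H = carr H"
  proof
    show "\<delta>H ` carr H \<subseteq> carr H"
      by (auto simp: \<delta>H_def)
    show "carr H \<subseteq> \<delta>H ` carr H"
    proof
      fix Y assume Y: "Y \<in> carr H"
      then obtain Z where Z: "Z \<in> carr L" "Y = \<delta> Z"
        using \<delta>_bij by (metis H_carr_simps(1) bij_betw_def imageE)
      have "\<alpha> * B f Z = - B f Y"
        using Z \<delta>_skew[of f Z] by simp
      then have "B f Z = 0"
        using Y \<alpha>_nonzero by simp
      then have "\<delta>H (proj Z) = Y"
        using Z Y by (simp add: \<delta>H_def)
      then show "Y \<in> \<delta>H ` carr H"
        using Z(1) by (metis imageI proj_carr)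
    qed
  qed
qed

lemma H_\<omega>: "X \<in> carr H \<Longrightarrow> Y \<in> carr H \<Longrightarrow> \<omega> X Y = B (\<delta>H X) Y"
  by (simp add: symplectic_form \<delta>H_def)

text \<open>Here \<open>\<omega> X f = B (\<delta> X) f = - \<alpha> * B X f = 0\<close>, so
  dropping a multiple of \<open>f\<close> changes nothing.\<close>

lemma \<omega>_proj: "X \<in> carr H \<Longrightarrow> Y \<in> carr L \<Longrightarrow> B f Y = 0 \<Longrightarrow> \<omega> X (proj Y) = \<omega> X Y"
  using \<delta>_skew[of X f] by (simp add: symplectic_form) (simp add: proj_def)

lemma H_symplectic: "symplectic H \<omega>"
  unfolding symplectic_def even_nondegenerate_form_def
proof (intro conjI allI ballI impI)
  show "lie_superalgebra H"
    by (rule H_lie_superalgebra)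
  show "bilinear_from (scl H) (*) (carr H) \<omega>"
    using symplectic H_carr_simps(1) unfolding symplectic_def even_nondegenerate_form_def bilinear_from_def linear_from_def
    by (metis H_simps(1))
next
  fix X Y assume XY: "X \<in> grade H 0" "Y \<in> grade H 1"
  show "\<omega> X Y = 0" "\<omega> Y X = 0"
    using symplectic XY unfolding symplectic_def even_nondegenerate_form_def by (meson H_grade_simps(1))+
next
  fix X assume X: "X \<in> carr H" "\<forall>Y\<in>carr H. \<omega> X Y = 0"
  have "\<delta>H X \<in> carr H"
    using X(1) by (simp add: \<delta>H_def)
  moreover have "\<forall>Y\<in>carr H. B (\<delta>H X) Y = 0"
    using X by (simp add: H_\<omega>[symmetric])
  ultimately have "\<delta>H X = \<delta>H 0"
    using H_quadratic unfolding quadratic_def even_nondegenerate_form_def by (simp add: \<delta>H_def)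
  then show "X = 0"
    using \<delta>H_bij X(1) subspace_0[OF H_carr_subspace] by (metis bij_betw_def inj_onD)
next
  fix x y X Y assume "X \<in> grade H x" "Y \<in> grade H y"
  then show "\<omega> X Y = - psign (x * y) * \<omega> Y X"
    using symplectic unfolding symplectic_def by (meson H_grade_simps(1))
next
  fix x y z X Y Z assume *: "X \<in> grade H x" "Y \<in> grade H y" "Z \<in> grade H z"
  then have "X \<in> grade L x" "Y \<in> grade L y" "Z \<in> grade L z"
    by auto
  then have "psign (x * z) * \<omega> X (brk L Y Z) + psign (y * x) * \<omega> Y (brk L Z X)
        + psign (z * y) * \<omega> Z (brk L X Y) = 0"
    using symplectic unfolding symplectic_def by blast
  moreover have "X \<in> carr H" "Y \<in> carr H" "Z \<in> carr H"
    using * by auto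
  ultimately show "psign (x * z) * \<omega> X (brk H Y Z) + psign (y * x) * \<omega> Y (brk H Z X)
        + psign (z * y) * \<omega> Z (brk H X Y) = 0"
    by (simp add: \<omega>_proj)
qed

lemma H_represents: "represents_symplectic H B \<omega> \<delta>H"
  unfolding represents_symplectic_def skew_superderivation_def superderivation_def
proof (intro conjI allI ballI)
  show "linear_from (scl H) (scl H) (carr H) \<delta>H"
    by (simp add: linear_from_def \<delta>H_def)
  show "\<delta>H ` grade H i \<subseteq> grade H (0 + i)" for i
    unfolding add_0_left by (auto simp: \<delta>H_def)
next
  fix x X Y assume "X \<in> grade H x" "Y \<in> carr H"
  moreover from this have "X \<in> carr H" by simp
  ultimately show "\<delta>H (brk H X Y) = brk H (\<delta>H X) Y + scl H (psign (0 * x)) (brk H X (\<delta>H Y))"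
    and "B (\<delta>H X) Y = - psign (0 * x) * B X (\<delta>H Y)"
    using \<delta>_skew[of X Y] by (simp_all add: \<delta>H_def \<delta>_brk)
qed (simp_all add: \<delta>H_bij H_\<omega>)

section \<open>The data of the extension and their compatibility conditions\<close>

lemma D_skew_superderivation: "skew_superderivation H B 1 D"
  unfolding skew_superderivation_def superderivation_def
proof (intro conjI allI ballI)
  show "linear_from (scl H) (scl H) (carr H) D"
    by (simp add: linear_from_def D_def)
  show "D ` grade H i \<subseteq> grade H (1 + i)" for i
    unfolding D_def by (intro image_subsetI proj_grade brk_grade e H_grade_simps(1))
next
  fix x X Y assume X: "X \<in> grade H x" and Y: "Y \<in> carr H"
  then have *: "X \<in> grade L x" "X \<in> carr H" "Y \<in> carr L" by auto
  then show "D (brk H X Y) = brk H (D X) Y + scl H (psign (1 * x)) (brk H X (D Y))"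
    using leibniz[OF e *(1,3)] by (simp add: D_def)
  have "brk L X e = - scl L (psign x) (brk L e X)"
    using brk_skew[OF *(1) e] by simp
  then have "B X (brk L e Y) = - psign x * B (brk L e X) Y"
    using * form_invariant[of X e Y] by simp
  moreover have "B (D X) Y = B (brk L e X) Y" "B X (D Y) = B X (brk L e Y)"
    using * Y by (simp_all add: D_def)
  ultimately show "B (D X) Y = - psign (1 * x) * B X (D Y)"
    by simp
qed

text \<open>The Jacobi identity for \<open>e\<close> taken three times gives three times this
  bracket equal to zero; characteristic zero allows division by 3.\<close>

lemma brk_e_X0: "brk L e X0 = 0"
proof -
  have "brk L e X0 = brk L X0 e - brk L e X0"
    using leibniz[OF e e, of e] by simp
  moreover have "brk L X0 e = - brk L e X0"
    using brk_skew_even[of X0 e] by simp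
  ultimately have "scl L 3 (brk L e X0) = 0"
    using scale_left_distrib[of 1 2 "brk L e X0"] scale_left_distrib[of 1 1 "brk L e X0"]
    by (simp add: algebra_simps eq_neg_iff_add_eq_0)
  then show ?thesis
    by simp
qed

text \<open>The bracket is orthogonal to \<open>f\<close>, so it has no component along
  \<open>e\<close>; by invariance its coefficient along \<open>f\<close> is
  \<open>- B X0 X\<close>.\<close>

lemma brk_e:
  assumes "X \<in> carr H"
  shows "brk L e X = D X - scl L (B X X0) f"
proof -
  have "B (brk L e X) e = - B X0 X"
    using form_skew_odd[OF e, of "brk L e X"] form_invariant[of e e X] assms by simp
  also have "B X0 X = B X X0"
    using form_sym_even[of X0 X] assms by simp
  finally show ?thesis
    using assms by (simp add: D_def proj_def)
qed

lemma brk_H: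
  assumes "X \<in> carr H" "Y \<in> carr H"
  shows "brk L X Y = brk H X Y - scl L (B (D X) Y) f"
proof -
  have "B (brk L X Y) e = - B (D X) Y"
    using form_skew_odd[OF e, of "brk L X Y"] form_invariant[of e X Y] assms by (simp add: D_def)
  then show ?thesis
    using assms by (simp add: proj_def)
qed

lemma D_X0: "D X0 = 0"
  by (simp add: D_def brk_e_X0)

lemma form_X0_X0: "B X0 X0 = 0"
  using form_invariant[of e e X0] brk_e_X0 by simp

text \<open>For the odd \<open>e\<close> the Leibniz rule reads
  \<open>[e,[e,X]] = [[e,e],X] - [e,[e,X]]\<close>.\<close>

lemma D_D:
  assumes "X \<in> carr H"
  shows "D (D X) = scl H (1 / 2) (brk H X0 X)"
proof -
  have "scl L 2 (brk L e (brk L e X)) = brk L X0 X"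
    using leibniz[OF e e, of X] scale_left_distrib[of 1 1 "brk L e (brk L e X)"] assms
    by (simp add: algebra_simps)
  then have "brk L e (brk L e X) = scl L (1 / 2) (brk L X0 X)"
    using scale_scale[of "1 / 2" 2 "brk L e (brk L e X)"] by simp
  then show ?thesis
    using assms by (simp add: D_def)
qed

text \<open>Skewness fixes the coefficient of \<open>e\<close>:
  \<open>B f (\<delta> e) = - B (\<delta> f) e = - \<alpha>\<close>.\<close>

lemma \<delta>_e: "\<delta> e = scl L \<mu> f + A1 - scl L \<alpha> e"
  using \<delta>_skew[of f e] by (simp add: A1_def \<mu>_def proj_def)

lemma A1_grade [simp]: "A1 \<in> grade H 1"
  by (simp add: A1_def)

lemma A1_carr [simp]: "A1 \<in> carr H"
  by (rule H_grade_simps(2)[OF A1_grade])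

text \<open>Apply \<delta> to \<open>[e,X]\<close> and project. In \<open>\<delta> e\<close> the
  multiple of \<open>f\<close> is central and drops out, and the term along \<open>e\<close>
  contributes \<open>- \<alpha>\<close> times \<open>D X\<close>.\<close>

lemma \<delta>_D:
  assumes "X \<in> carr H"
  shows "\<delta>H (D X) - D (\<delta>H X) + scl H \<alpha> (D X) = brk H A1 X"
  using arg_cong[OF \<delta>_brk[of e X], of proj] assms by (simp add: \<delta>_e D_def \<delta>H_def)

text \<open>The same computation for \<open>[e,e]\<close>, which gives
  \<open>\<delta> X0 = 2 [e,A1] - 2 \<alpha> X0\<close>.\<close>

lemma D_A1: "D A1 = scl H \<alpha> X0 + scl H (1 / 2) (\<delta>H X0)"
proof -
  have "brk L A1 e = brk L e A1"
    using brk_parity_aut[OF e, of A1] H_grade_simps(1)[OF A1_grade] by simp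
  then have "\<delta> X0 = scl L 2 (brk L e A1) - scl L (2 * \<alpha>) X0"
    using \<delta>_brk[of e e] scale_left_distrib[of 1 1 "brk L e A1"]
      scale_left_distrib[of \<alpha> \<alpha> X0] by (simp add: \<delta>_e algebra_simps)
  then have "scl L (1 / 2) (\<delta> X0) = brk L e A1 - scl L \<alpha> X0"
    by (simp add: scale_right_diff_distrib)
  moreover have "D A1 = brk L e A1"
    using H_grade_simps(1)[OF A1_grade] by (simp add: D_def)
  ultimately show ?thesis
    by (simp add: \<delta>H_def)
qed

section \<open>Recovering the algebra from its reduction\<close>

lemma parity_aut_H:
  assumes "X \<in> carr H"
  shows "parity_aut H X = parity_aut L X" "parity_aut L X \<in> carr H"
proof -
  interpret H: lie_super H by (rule H_lie_super)
  obtain Y0 Y1 where Y: "Y0 \<in> grade H 0" "Y1 \<in> grade H 1" "X = Y0 + Y1"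
    using assms H.carr_cases by blast
  then have "Y1 \<in> grade L 1" "Y0 \<in> grade L 0" "Y0 - Y1 \<in> carr H"
    using H.carr_closed(3)[of Y0 Y1] by auto
  then show "parity_aut H X = parity_aut L X" "parity_aut L X \<in> carr H"
    using H.parity_aut_add[OF Y(1,2)] Y(3) parity_aut_add[of Y0 Y1] by simp_all
qed

text \<open>The vector \<open>f\<close> takes the place of the dual vector of \<open>e\<close>, with
  which it shares being central and \<open>B f e = 1\<close>.\<close>

definition emb :: "'k \<times> 'a \<times> 'k \<Rightarrow> 'a" where
  "emb u = scl L (fst u) e + fst (snd u) + scl L (snd (snd u)) f"

lemma emb_simp [simp]: "emb (a, X, b) = scl L a e + X + scl L b f"
  by (simp add: emb_def)

lemma emb_form:
  assumes "X \<in> carr H" "X' \<in> carr H"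
  shows "B (emb (a, X, b)) (emb (a', X', b')) = ext_form B (a, X, b) (a', X', b')"
  using assms by simp

lemma emb_brk:
  assumes "X \<in> carr H" "X' \<in> carr H"
  shows "emb (gen_brk H B D X0 (a, X, b) (a', X', b')) = brk L (emb (a, X, b)) (emb (a', X', b'))"
proof -
  note X = parity_aut_H[OF assms(1)]
  have "brk L (emb (a, X, b)) (emb (a', X', b')) =
      scl L (a * a') X0 + scl L a (brk L e X') + scl L a' (brk L X e) + brk L X X'"
    using assms by (simp add: algebra_simps)
  also have "brk L e X' = D X' - scl L (B X' X0) f"
    using brk_e assms by simp
  also have "brk L X e = - D (parity_aut L X) + scl L (B (parity_aut L X) X0) f"
    using brk_parity_aut[OF e, of X] brk_e[OF X(2)] assms by simp
  also have "brk L X X' = brk H X X' - scl L (B (D X) X') f"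
    using brk_H assms by simp
  finally show ?thesis
    by (simp add: X(1) algebra_simps)
qed

lemma emb_\<delta>:
  assumes "X \<in> carr H"
  shows "emb (gen_delta H B \<delta>H \<alpha> \<mu> A1 (a, X, b)) = \<delta> (emb (a, X, b))"
proof -
  have "B (\<delta> X) e = - B X A1"
    using \<delta>_skew[of X e] assms by (simp add: \<delta>_e)
  then have "\<delta> X = \<delta>H X - scl L (B X A1) f"
    using assms by (simp add: \<delta>H_def proj_def)
  then show ?thesis
    using assms by (simp add: \<delta>_e algebra_simps)
qed

lemma emb_inverse: "X \<in> carr L \<Longrightarrow> emb (B f X, proj X, B X e) = X"
  by (simp add: proj_def)

lemma ext_carr:
  assumes "scl E = ext_scl H" "grade E = ext_grade H"
  shows "carr E = UNIV \<times> carr H \<times> UNIV"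
proof -
  have "carr E = {u + v |u v. u \<in> ext_grade H 0 \<and> v \<in> ext_grade H 1}"
    by (simp add: carr_def assms)
  also have "\<dots> = UNIV \<times> carr H \<times> UNIV"
  proof (intro equalityI subsetI)
    fix w assume "w \<in> {u + v |u v. u \<in> ext_grade H 0 \<and> v \<in> ext_grade H 1}"
    then show "w \<in> UNIV \<times> carr H \<times> UNIV"
      by (auto simp: ext_grade_def carr_def[of H])
  next
    fix w :: "'k \<times> 'a \<times> 'k" assume "w \<in> UNIV \<times> carr H \<times> UNIV"
    then obtain a Y0 Y1 b where "Y0 \<in> grade H 0" "Y1 \<in> grade H 1" "w = (0, Y0, 0) + (a, Y1, b)"
      by (auto simp: carr_def[of H])
    then show "w \<in> {u + v |u v. u \<in> ext_grade H 0 \<and> v \<in> ext_grade H 1}"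
      by (auto simp: ext_grade_def)
  qed
  finally show ?thesis .
qed

text \<open>Bracket and derivation need to agree with the generalized formulas only on the carrier,
  so the elementary extension, where those formulas degenerate, is covered too.\<close>

lemma emb_qs_isomorphism:
  assumes "scl E = ext_scl H" "grade E = ext_grade H"
    and "\<And>u v. u \<in> UNIV \<times> carr H \<times> UNIV \<Longrightarrow> v \<in> UNIV \<times> carr H \<times> UNIV \<Longrightarrow>
      brk E u v = gen_brk H B D X0 u v"
    and "\<And>u. u \<in> UNIV \<times> carr H \<times> UNIV \<Longrightarrow> \<Delta> u = gen_delta H B \<delta>H \<alpha> \<mu> A1 u"
  shows "qs_isomorphism E (ext_form B) (\<lambda>u v. ext_form B (\<Delta> u) v) L B \<omega> emb"
  unfolding qs_isomorphism_def
proof (intro conjI allI ballI)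
  note carr = ext_carr[OF assms(1,2)]
  show "linear_from (scl E) (scl L) (carr E) emb"
    by (auto simp: linear_from_def carr assms(1) add_Pair algebra_simps)
  show "bij_betw emb (carr E) (carr L)"
    unfolding carr
  proof (rule bij_betw_byWitness[where f' = "\<lambda>X. (B f X, proj X, B X e)"])
    show "\<forall>u\<in>UNIV \<times> carr H \<times> UNIV. (B f (emb u), proj (emb u), B (emb u) e) = u"
      by auto
    show "\<forall>X\<in>carr L. emb (B f X, proj X, B X e) = X"
      using emb_inverse by blast
  qed auto
  show "emb ` grade E i \<subseteq> grade L i" for i
    by (cases i) (auto simp: assms(2) ext_grade_def)
next
  fix u v assume "u \<in> carr E" "v \<in> carr E"
  then obtain a X b a' X' b' where uv: "u = (a, X, b)" "v = (a', X', b')" "X \<in> carr H" "X' \<in> carr H"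
    unfolding ext_carr[OF assms(1,2)] by auto
  have "brk E u v = gen_brk H B D X0 u v" and \<Delta>: "\<Delta> u = gen_delta H B \<delta>H \<alpha> \<mu> A1 u"
    using assms(3,4) uv by blast+
  then show "emb (brk E u v) = brk L (emb u) (emb v)"
    using emb_brk uv by metis
  show "B (emb u) (emb v) = ext_form B u v"
    using emb_form uv by blast
  have "\<omega> (emb u) (emb v) = B (\<delta> (emb u)) (emb v)"
    using uv by (simp add: symplectic_form)
  also have "\<delta> (emb u) = emb (\<Delta> u)"
    using emb_\<delta> uv \<Delta> by metis
  also have "B (emb (\<Delta> u)) (emb v) = ext_form B (\<Delta> u) v"
  proof -
    have "\<delta>H X + scl L a A1 \<in> carr H"
      using uv subspace_add[OF H_carr_subspace] subspace_scale[OF H_carr_subspace] by (simp add: \<delta>H_def)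
    then show ?thesis
      using emb_form[of "\<delta>H X + scl L a A1" X'] uv \<Delta> by (simp del: emb_simp ext_form.simps)
  qed
  finally show "\<omega> (emb u) (emb v) = ext_form B (\<Delta> u) v" .
qed

lemma f_nonzero: "f \<noteq> 0"
  by (metis form_f_e form_linear(8) ef_carr(1) zero_neq_one)

text \<open>The chain from \<open>H\<close> to the orthogonal of \<open>f\<close> to
  \<open>L\<close> gains one dimension at each step, first through \<open>f\<close> and then through
  \<open>e\<close>.\<close>

lemma finite_dim_H:
  assumes "finite_dim L"
  shows "finite_dim H" "dim (carr H) + 2 = dim (carr L)"
proof -
  obtain T where T: "finite T" "carr L = span T"
    using assms by (rule finite_dimE)
  let ?U = "{X \<in> carr L. B f X = 0}"
  have U: "subspace ?U"
    by (auto simp: subspace_def)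
  have HU: "carr H \<subseteq> ?U"
    by auto
  have "carr H \<subseteq> span T"
    using HU T(2) by auto
  then obtain A where "finite A" "A \<subseteq> carr H" "span A = carr H"
    using finite_basis_of_subspace[OF H_carr_subspace _ T(1)] by metis
  then show "finite_dim H"
    unfolding finite_dim_def H_simps by blast
  have "dim ?U = Suc (dim (carr H))"
  proof (rule dim_hyperplane[OF H_carr_subspace U HU _ T(1), of f])
    show "?U \<subseteq> span T"
      using T(2) by blast
    show "f \<in> ?U"
      by simp
    show "f \<notin> carr H"
      using H_carr_simps(3)[of f] by auto
    show "\<exists>c. X - scl L c f \<in> carr H" if "X \<in> ?U" for X
      using that proj_carr[of X] by (intro exI[of _ "B X e"]) (simp add: proj_def)
  qed
  moreover have "dim (carr L) = Suc (dim ?U)"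
  proof (rule dim_hyperplane[OF U carr_subspace _ _ T(1), of e])
    show "carr L \<subseteq> span T"
      using T(2) by blast
    show "\<exists>c. X - scl L c e \<in> ?U" if "X \<in> carr L" for X
      using that by (intro exI[of _ "B f X"]) simp
  qed auto
  ultimately show "dim (carr H) + 2 = dim (carr L)"
    by simp
qed

lemma generalized_double_extension:
  assumes "filiform_flag H n W" "\<exists>X\<in>grade H 0. D X \<in> W n - W (n - 1)" "X0 \<noteq> 0"
  shows "generalized_double_extension_of L B \<omega> e H B \<omega>"
proof -
  have "X0 \<in> grade H 0"
    unfolding H_grade_0 by simp
  then have "gen_ext_data H B \<omega> \<delta>H n W D X0 \<alpha> A1"
    unfolding gen_ext_data_def quadratic_symplectic_def
    using assms H_quadratic H_symplectic H_represents D_skew_superderivation D_X0 form_X0_X0 D_D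
      \<alpha>_nonzero A1_grade \<delta>_D D_A1 by blast
  moreover have "qs_isomorphism (gen_ext H B D X0) (ext_form B)
      (\<lambda>u v. ext_form B (gen_delta H B \<delta>H \<alpha> \<mu> A1 u) v) L B \<omega> emb"
    by (rule emb_qs_isomorphism) (simp_all add: gen_ext_def)
  moreover have "emb (1, 0, 0) = e"
    by simp
  ultimately show ?thesis
    unfolding generalized_double_extension_of_def by blast
qed

text \<open>Without odd part in \<open>H\<close> the odd objects \<open>D\<close> and
  \<open>A1\<close> vanish, and the eigenvector condition kills \<mu>, so the generalized formulas
  reduce to the elementary ones. The formula for \<open>D D\<close> then makes \<open>X0\<close>
  central in \<open>H\<close>, and the one for \<open>D A1\<close> gives the eigenvalue
  \<open>- 2 * \<alpha>\<close>.\<close>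

lemma elementary_double_extension:
  assumes odd: "grade H 1 = {0}" and \<delta>e: "\<delta> e = - scl L \<alpha> e" and "X0 \<noteq> 0"
  shows "elementary_odd_double_extension L B \<omega>"
proof -
  have carr: "X \<in> grade L 0" if "X \<in> carr H" for X
    using that odd unfolding carr_def[of H] H_grade_0 by auto
  have D: "D X = 0" if "X \<in> carr H" for X
    using proj_grade[of "brk L e X" 1] carr[OF that] odd by (simp add: D_def)
  have A1: "A1 = 0"
    using A1_grade odd by auto
  have \<mu>: "\<mu> = 0"
    using \<delta>e by (simp add: \<mu>_def)
  have "X0 \<in> center H"
    using D_D D subspace_0[OF H_carr_subspace] by (auto simp: center_def)
  moreover have "\<delta>H X0 = scl H (- 2 * \<alpha>) X0"
  proof -
    have "scl L 2 (scl L \<alpha> X0 + scl L (1 / 2) (\<delta>H X0)) = 0"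
      using D_A1 A1 D[of A1] by simp
    then show ?thesis
      by (simp add: scale_right_distrib eq_neg_iff_add_eq_0 add.commute)
  qed
  ultimately have data: "elem_ext_data H B \<omega> \<delta>H X0 (- 2 * \<alpha>)"
    unfolding elem_ext_data_def quadratic_symplectic_def
    using assms(3) odd H_quadratic H_symplectic H_represents form_X0_X0 \<alpha>_nonzero by auto
  have "qs_isomorphism (elem_ext H B X0) (ext_form B)
      (\<lambda>u v. ext_form B (elem_delta \<delta>H (- 2 * \<alpha>) u) v) L B \<omega> emb"
    by (rule emb_qs_isomorphism)
      (auto simp: elem_ext_def D A1 \<mu> carr parity_aut_H simp del: even_carr_H)
  then show ?thesis
    unfolding elementary_odd_double_extension_def using data by blast
qed

end

section \<open>The flag of a filiform quadratic Lie superalgebra\<close>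

locale filiform_quadratic = quadratic_super L B
  for L :: "('k::field_char_0, 'a::ab_group_add) superalgebra" and B :: "'a \<Rightarrow> 'a \<Rightarrow> 'k" +
  fixes m :: nat and V :: "nat \<Rightarrow> 'a set"
  assumes finite_dim: "finite_dim L"
    and flag: "filiform_flag L m V"
    and m: "2 \<le> m"
begin

lemma V_top: "V m = grade L 1"
  using flag unfolding filiform_flag_def by blast

lemma V_subspace: "i \<le> m \<Longrightarrow> subspace (V i)"
  using flag unfolding filiform_flag_def by blast

lemma V_dim: "i \<le> m \<Longrightarrow> dim (V i) = i"
  using flag unfolding filiform_flag_def by blast

lemma V_Suc: "i < m \<Longrightarrow> V i \<subseteq> V (Suc i)"
  using flag unfolding filiform_flag_def by blast

lemma V_span: "i < m \<Longrightarrow> span {brk L X v | X v. X \<in> grade L 0 \<and> v \<in> V (Suc i)} = V i"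
  using flag unfolding filiform_flag_def by blast

lemma V_mono: "i \<le> j \<Longrightarrow> j \<le> m \<Longrightarrow> V i \<subseteq> V j"
proof (induction j rule: dec_induct)
  case (step j)
  then show ?case
    using V_Suc[of j] by auto
qed simp

lemma V_odd: "i \<le> m \<Longrightarrow> v \<in> V i \<Longrightarrow> v \<in> grade L 1"
  using V_mono[of i m] V_top by auto

lemma V_carr: "i \<le> m \<Longrightarrow> v \<in> V i \<Longrightarrow> v \<in> carr L"
  using V_odd grade_carr by blast

lemma brk_V:
  assumes "i < m" "X \<in> grade L 0" "v \<in> V (Suc i)"
  shows "brk L X v \<in> V i"
  unfolding V_span[OF assms(1), symmetric] using assms(2,3) by (intro span_base) blast

text \<open>Members of the flag below the top are spans of brackets, so only brackets need checking.
  This is the induction principle for descending the flag.\<close>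

lemma V_minimal:
  assumes "i < m" "subspace S" "\<And>X v. X \<in> grade L 0 \<Longrightarrow> v \<in> V (Suc i) \<Longrightarrow> brk L X v \<in> S"
  shows "V i \<subseteq> S"
  unfolding V_span[OF assms(1), symmetric] using assms(2,3) by (intro span_minimal) auto

lemma V_finite:
  obtains T where "finite T" "\<And>i. i \<le> m \<Longrightarrow> V i \<subseteq> span T"
proof -
  obtain T where "finite T" "carr L = span T"
    using finite_dim by (rule finite_dimE)
  moreover from this have "V i \<subseteq> span T" if "i \<le> m" for i
    using V_carr[OF that] by auto
  ultimately show thesis
    by (intro that)
qed

lemma V_zero: "V 0 = {0}"
proof -
  obtain T where "finite T" "\<And>i. i \<le> m \<Longrightarrow> V i \<subseteq> span T"
    by (rule V_finite) blast
  then show ?thesis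
    using dim_zero_subspace[OF V_subspace[of 0]] V_dim[of 0] by blast
qed

lemma V_complement:
  assumes "i < m" "e \<in> V (Suc i)" "e \<notin> V i" "v \<in> V (Suc i)"
  shows "\<exists>c. v - scl L c e \<in> V i"
proof -
  obtain T where "finite T" "\<And>i. i \<le> m \<Longrightarrow> V i \<subseteq> span T"
    by (rule V_finite) blast
  then show ?thesis
    using hyperplane_complement[of "V i" "V (Suc i)" T e v] assms V_subspace[of i] V_subspace[of "Suc i"]
      V_Suc[of i] V_dim[of i] V_dim[of "Suc i"] by auto
qed

lemma m_pred: "Suc (m - 1) = m" "m - 1 < m"
  using m by simp_all

section \<open>The line at the bottom of the flag\<close>

lemma V_1_form:
  assumes v: "v \<in> V 1" and "w \<in> V (m - 1)"
  shows "B v w = 0"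
proof -
  have vc: "v \<in> carr L"
    using V_carr[of 1] v m by simp
  have "V (m - 1) \<subseteq> {w \<in> carr L. B v w = 0}"
  proof (rule V_minimal)
    fix X u assume X: "X \<in> grade L 0" and "u \<in> V (Suc (m - 1))"
    then have u: "u \<in> carr L"
      using V_carr[of m] m_pred by simp
    \<comment> \<open>The bracket lies in \<open>V 0\<close>, which is zero.\<close>
    have "brk L X v = 0"
      using brk_V[of 0 X v] X v m V_zero by simp
    then have "brk L v X = 0"
      using brk_skew_even[OF X vc] by simp
    then have "B v (brk L X u) = 0"
      using form_invariant[of v X u] vc X u by simp
    then show "brk L X u \<in> {w \<in> carr L. B v w = 0}"
      using X u by simp
  qed (use m vc in \<open>auto simp: subspace_def\<close>)
  then show ?thesis
    using assms(2) by blast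
qed

text \<open>Even vectors kill \<open>v\<close> because \<open>V 0\<close> is zero. For odd
  \<open>Y\<close> the bracket is even, and pairing it with an even \<open>Z0\<close> gives
  \<open>B v [Y,Z0]\<close>, which vanishes because \<open>[Y,Z0]\<close> lies in
  \<open>V (m - 1)\<close>.\<close>

lemma V_1_central:
  assumes v: "v \<in> V 1" and "Y \<in> carr L"
  shows "brk L v Y = 0"
proof -
  have vo: "v \<in> grade L 1" and vc: "v \<in> carr L"
    using V_odd[of 1] V_carr[of 1] v m by simp_all
  have even: "brk L v Y = 0" if Y: "Y \<in> grade L 0" for Y
    using brk_V[of 0 Y v] brk_skew_even[OF Y vc] Y v m V_zero by simp
  have odd: "brk L v Y = 0" if Y: "Y \<in> grade L 1" for Y
  proof (rule form_nondegenerate)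
    fix Z assume "Z \<in> carr L"
    then obtain Z0 Z1 where Z: "Z0 \<in> grade L 0" "Z1 \<in> grade L 1" "Z = Z0 + Z1"
      using carr_cases by blast
    have "brk L Z0 Y \<in> V (m - 1)"
      using brk_V[of "m - 1" Z0 Y] Z Y m_pred V_top by simp
    then have "B v (brk L Z0 Y) = 0"
      by (rule V_1_form[OF v])
    moreover have "brk L Y Z0 = - brk L Z0 Y"
      using brk_skew_even[OF Z(1), of Y] Y by simp
    ultimately have "B v (brk L Y Z0) = 0"
      using Y Z vc by simp
    moreover have "B (brk L v Y) Z1 = 0"
      using vo Y Z by (meson brk_grade'(3) form_even(1))
    ultimately show "B (brk L v Y) Z = 0"
      using form_invariant[of v Y Z0] vc vo Y Z by simp
  qed (use vc Y in simp)
  obtain Y0 Y1 where "Y0 \<in> grade L 0" "Y1 \<in> grade L 1" "Y = Y0 + Y1"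
    using assms(2) carr_cases by blast
  then show ?thesis
    using even[of Y0] odd[of Y1] vc by simp
qed

text \<open>If \<open>f\<close> were orthogonal to some odd \<open>w\<close> outside the hyperplane
  \<open>V (m - 1)\<close>, it would be orthogonal to the whole odd part, against
  nondegeneracy.\<close>

lemma V_1_form_zero_iff:
  assumes f: "f \<in> V 1" "f \<noteq> 0" and w: "w \<in> grade L 1"
  shows "B f w = 0 \<longleftrightarrow> w \<in> V (m - 1)"
proof
  have fo: "f \<in> grade L 1"
    using V_odd[of 1] f m by simp
  assume 0: "B f w = 0"
  show "w \<in> V (m - 1)"
  proof (rule ccontr)
    assume "w \<notin> V (m - 1)"
    have "B f u = 0" if u: "u \<in> grade L 1" for u
    proof -
      obtain c where c: "u - scl L c w \<in> V (m - 1)"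
        using V_complement[of "m - 1" w u] \<open>w \<notin> V (m - 1)\<close> w u m_pred V_top by auto
      then have "B f (u - scl L c w) = 0"
        using V_1_form f(1) by blast
      then show ?thesis
        using 0 w that fo by simp
    qed
    then have "f = 0"
      using fo by (intro form_nondegenerate) (auto elim!: carr_cases)
    then show False
      using f by simp
  qed
qed (use V_1_form f in blast)

lemma V_1_nonzero: obtains f where "f \<in> V 1" "f \<noteq> 0"
proof -
  have "dim {0} = 0"
    by (metis V_dim V_zero le0)
  then have "V 1 \<noteq> {0}"
    using V_dim[of 1] m by auto
  moreover have "0 \<in> V 1"
    using V_subspace[of 1] subspace_0 m by simp
  ultimately show thesis
    using that by blast
qed

lemma V_proper: "0 < i \<Longrightarrow> i \<le> m \<Longrightarrow> \<not> V i \<subseteq> V (i - 1)"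
  using V_dim[of i] V_dim[of "i - 1"] V_mono[of "i - 1" i]
  by (metis diff_le_self le_trans less_imp_diff_less less_irrefl not_less subset_antisym diff_less zero_less_one)

text \<open>Polarisation: if all these squares vanished, then \<open>[\<gg>\<^sub>1, \<gg>\<^sub>1] = 0\<close> and, by invariance,
  \<open>[\<gg>\<^sub>0, \<gg>\<^sub>1] = 0\<close>, so that \<open>V\<^sub>1 = 0\<close>.\<close>

lemma square_nonzero: obtains e where "e \<in> V m - V (m - 1)" "brk L e e \<noteq> 0"
proof (rule ccontr)
  note witness = that
  assume "\<not> thesis"
  then have top: "brk L v v = 0" if "v \<in> V m" "v \<notin> V (m - 1)" for v
    using witness that by blast
  obtain e where e: "e \<in> V m" "e \<notin> V (m - 1)"
    using V_proper[of m] m by auto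
  have two: "X + X = 0 \<Longrightarrow> X = 0" for X :: 'a
    using scale_left_distrib[of 1 1 X] by simp
  have sym: "brk L v u = brk L u v" if "u \<in> V m" "v \<in> V m" for u v
    using brk_parity_aut[of v u] that V_top by simp
  have sq: "brk L v v = 0" if v: "v \<in> V m" for v
  proof (cases "v \<in> V (m - 1)")
    case True
    \<comment> \<open>The vanishing is assumed only outside \<open>V (m - 1)\<close>. Both
      \<open>e + v\<close> and \<open>e - v\<close> stay outside, and adding their squares leaves
      twice the square of \<open>v\<close>.\<close>
    have "e + v \<notin> V (m - 1)" "e - v \<notin> V (m - 1)"
      using e True subspace_diff[OF V_subspace, of "m - 1" "e + v" v]
        subspace_add[OF V_subspace, of "m - 1" "e - v" v] m_pred by auto
    then have "brk L (e + v) (e + v) = 0" "brk L (e - v) (e - v) = 0" "brk L e e = 0"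
      using top e v V_top by auto
    then have "brk L v v + brk L e v + brk L e v = 0" "brk L v v - brk L e v - brk L e v = 0"
      using sym[OF e(1) v] e v V_top by (simp_all add: algebra_simps)
    then have "brk L v v + brk L v v = 0"
      by (metis (no_types, lifting) add.assoc add_diff_cancel_right' diff_add_cancel diff_add_eq add_0)
    then show ?thesis
      by (rule two)
  qed (use top v in blast)
  have odd: "brk L u v = 0" if "u \<in> V m" "v \<in> V m" for u v
    using sq[of "u + v"] sq[OF that(1)] sq[OF that(2)] sym[OF that] that V_top two[of "brk L u v"]
    by simp
  have "brk L X u = 0" if X: "X \<in> grade L 0" and u: "u \<in> V m" for X u
  proof (rule form_nondegenerate)
    fix Z assume "Z \<in> carr L"
    then obtain Z0 Z1 where Z: "Z0 \<in> grade L 0" "Z1 \<in> grade L 1" "Z = Z0 + Z1"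
      using carr_cases by blast
    have "B (brk L X u) Z1 = 0"
      using form_invariant[of X u Z1] odd[OF u, of Z1] X Z u V_top by simp
    moreover have "B (brk L X u) Z0 = 0"
      using form_even(2)[OF Z(1), of "brk L X u"] X u V_top by simp
    ultimately show "B (brk L X u) Z = 0"
      using X u V_top Z by simp
  qed (use X u V_top in simp)
  then have "V (m - 1) \<subseteq> {0}"
    using V_minimal[of "m - 1" "{0}"] m_pred by simp
  moreover have "\<not> V (m - 1) \<subseteq> V (m - 1 - 1)" "0 \<in> V (m - 1 - 1)"
    using V_proper[of "m - 1"] V_subspace[of "m - 1 - 1"] subspace_0 m by auto
  ultimately show False
    by blast
qed

text \<open>Descending induction from the odd part: a generator \<open>[X,v]\<close> of
  \<open>V i\<close> has \<open>v\<close> in \<open>V (Suc i)\<close>, and the derivation rule sends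
  it to \<open>[\<delta> X,v] + [X,\<delta> v]\<close>, again in \<open>V i\<close>.\<close>

lemma derivation_V:
  assumes der: "superderivation L 0 \<delta>" and "i \<le> m" "v \<in> V i"
  shows "\<delta> v \<in> V i"
proof -
  have lin: "linear_from (scl L) (scl L) (carr L) \<delta>"
    using der unfolding superderivation_def by blast
  have grade: "\<delta> X \<in> grade L i" if "X \<in> grade L i" for i X
    using der that unfolding superderivation_def by (metis add_0_left image_subset_iff)
  have leib: "\<delta> (brk L X Y) = brk L (\<delta> X) Y + brk L X (\<delta> Y)" if "X \<in> grade L 0" "Y \<in> carr L" for X Y
    using der that unfolding superderivation_def by simp
  note \<delta>_linear = linear_fromD[OF lin vector_space_axioms vector_space_axioms carr_subspace]
  \<comment> \<open>Keeping membership in \<open>V i\<close> inside the set confines it to the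
    carrier, where \<delta> is linear.\<close>
  have "V i \<subseteq> {v \<in> V i. \<delta> v \<in> V i}"
    using assms(2)
  proof (induction i rule: inc_induct)
    case base
    then show ?case
      using grade[of _ 1] V_top by auto
  next
    case (step i)
    have im: "i \<le> m"
      using step by simp
    show ?case
    proof (rule V_minimal)
      show "subspace {v \<in> V i. \<delta> v \<in> V i}"
        using V_carr[OF im] V_subspace[OF im] by (auto simp: subspace_def \<delta>_linear)
      fix X v assume X: "X \<in> grade L 0" and v: "v \<in> V (Suc i)"
      then have "\<delta> v \<in> V (Suc i)" "v \<in> carr L"
        using step V_carr[of "Suc i" v] by auto
      then show "brk L X v \<in> {v \<in> V i. \<delta> v \<in> V i}"
        using X v step grade[OF X] leib brk_V[of i] subspace_add[OF V_subspace[OF im]] by simp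
    qed (use step in simp)
  qed
  then show ?thesis
    using assms(3) by blast
qed

lemma hyperbolic_pair_exists:
  assumes "symplectic L \<omega>"
  obtains \<delta> e f \<alpha> where "odd_hyperbolic_pair L B \<omega> \<delta> e f \<alpha>"
    and "e \<in> V m - V (m - 1)" "brk L e e \<noteq> 0" "f \<in> V 1"
proof -
  obtain \<delta> where \<delta>: "represents_symplectic L B \<omega> \<delta>"
    using represents_symplectic_exists[OF finite_dim assms] by blast
  obtain e where e: "e \<in> V m - V (m - 1)" "brk L e e \<noteq> 0"
    by (rule square_nonzero)
  obtain f0 where f0: "f0 \<in> V 1" "f0 \<noteq> 0"
    by (rule V_1_nonzero)
  have eo: "e \<in> grade L 1" and f0o: "f0 \<in> grade L 1"
    using e V_top V_odd[of 1] f0 m by auto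
  \<comment> \<open>Since \<open>e\<close> avoids \<open>V (m - 1)\<close>, it pairs nontrivially
    with \<open>f0\<close>, and rescaling gives \<open>B f e = 1\<close>.\<close>
  define f where "f = scl L (1 / B f0 e) f0"
  have ne: "B f0 e \<noteq> 0"
    using V_1_form_zero_iff[OF f0 eo] e by blast
  have f: "f \<in> V 1" "B f e = 1" "f \<noteq> 0"
    using f0 f0o eo ne V_subspace[of 1] m by (auto simp: f_def subspace_scale)
  have "superderivation L 0 \<delta>"
    using \<delta> unfolding represents_symplectic_def skew_superderivation_def by blast
  then have "\<delta> f \<in> V 1"
    using derivation_V[of \<delta> 1 f] f m by simp
  then obtain \<alpha> where "\<delta> f = scl L \<alpha> f"
    using V_complement[of 0 f "\<delta> f"] f V_zero m by auto
  then have "odd_hyperbolic_pair L B \<omega> \<delta> e f \<alpha>"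
    using assms \<delta> eo f V_odd[of 1 f] m V_1_central by unfold_locales auto
  then show thesis
    using that e f(1) by blast
qed

lemma elementary_case:
  assumes "symplectic L \<omega>" and m2: "m = 2"
  shows "elementary_odd_double_extension L B \<omega>"
proof -
  obtain \<delta> e f \<alpha> where pair: "odd_hyperbolic_pair L B \<omega> \<delta> e f \<alpha>"
    and e: "e \<in> V m - V (m - 1)" and sq: "brk L e e \<noteq> 0" and f: "f \<in> V 1"
    by (rule hyperbolic_pair_exists[OF assms(1)])
  interpret P: odd_hyperbolic_pair L B \<omega> \<delta> e f \<alpha> by (rule pair)
  have line: "\<exists>c. X = scl L c f" if "X \<in> grade L 1" "B f X = 0" for X
  proof -
    have "X \<in> V 1"
      using V_1_form_zero_iff[OF f P.f_nonzero that(1)] that(2) m2 by simp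
    then show ?thesis
      using V_complement[of 0 f X] f P.f_nonzero V_zero m by auto
  qed
  \<comment> \<open>Stated for any odd \<open>e'\<close> with \<open>B e' f = - 1\<close>, because
    it serves for \<open>e\<close> and again for the corrected vector.\<close>
  have odd: "X = 0" if X: "X \<in> grade L 1" "B f X = 0" "B e' X = 0" and "B e' f = - 1" "e' \<in> grade L 1" for X e'
    using line[OF X(1,2)] that by auto
  have "P.A1 = 0"
    using odd[of P.A1 e] P.A1_grade[unfolded P.H_grade] P.form_e_f P.e by blast
  then have \<delta>e: "\<delta> e = scl L P.\<mu> f - scl L \<alpha> e"
    using P.\<delta>_e by simp
  \<comment> \<open>The coefficient solves \<open>\<delta> e' = - \<alpha> e'\<close>. As
    \<open>f\<close> is central and isotropic, neither the square nor the pairing with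
    \<open>f\<close> changes.\<close>
  define e' where "e' = e - scl L (P.\<mu> / (2 * \<alpha>)) f"
  have \<delta>e': "\<delta> e' = - scl L \<alpha> e'"
  proof -
    have "scl L P.\<mu> f = scl L (P.\<mu> / 2) f + scl L (P.\<mu> / 2) f"
      by (simp add: scale_left_distrib[symmetric])
    then show ?thesis
      using P.\<alpha>_nonzero by (simp add: e'_def \<delta>e algebra_simps)
  qed
  have e': "e' \<in> grade L 1" "B f e' = 1" "brk L e' e' = brk L e e"
    by (simp_all add: e'_def)
  interpret Q: odd_hyperbolic_pair L B \<omega> \<delta> e' f \<alpha>
    using P.symplectic P.represents e' by unfold_locales simp_all
  have "grade Q.H 1 = {0}"
    using odd[of _ e'] by (auto simp: Q.H_grade simp del: Q.H_grade_simps)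
  then show ?thesis
    using Q.elementary_double_extension \<delta>e' e' sq by simp
qed

lemma generalized_case:
  assumes "symplectic L \<omega>" and m2: "m > 2"
  shows "\<exists>(H :: ('k, 'a) superalgebra) B\<^sub>H \<omega>\<^sub>H e\<^sub>m.
    quadratic_symplectic H B\<^sub>H \<omega>\<^sub>H \<and> (\<exists>n W. filiform_flag H n W) \<and> finite_dim H \<and>
    vector_space.dim (scl H) (carr H) + 2 = dim (carr L) \<and>
    e\<^sub>m \<in> V m - V (m - 1) \<and> generalized_double_extension_of L B \<omega> e\<^sub>m H B\<^sub>H \<omega>\<^sub>H"
proof -
  obtain \<delta> e f \<alpha> where pair: "odd_hyperbolic_pair L B \<omega> \<delta> e f \<alpha>"
    and e: "e \<in> V m - V (m - 1)" and sq: "brk L e e \<noteq> 0" and f: "f \<in> V 1"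
    by (rule hyperbolic_pair_exists[OF assms(1)])
  interpret P: odd_hyperbolic_pair L B \<omega> \<delta> e f \<alpha> by (rule pair)
  have f_V: "f \<in> V i" if "0 < i" "i \<le> m" for i
    using f V_mono[of 1 i] that by auto
  have form_f: "B f v = 0" if "i < m" "v \<in> V i" for i v
  proof -
    have "V i \<subseteq> V (m - 1)"
      using that(1) by (intro V_mono) auto
    then show ?thesis
      using V_1_form[OF f] that(2) by blast
  qed
  have proj_V: "P.proj v = v - scl L (B v e) f" if "i < m" "v \<in> V i" for i v
    using form_f[OF that] by (simp add: P.proj_def)
  have proj_V_iff: "P.proj v \<in> V i \<longleftrightarrow> v \<in> V i" if "0 < i" "i < m" "v \<in> V (m - 1)" for i v
  proof -
    have S: "subspace (V i)"
      using V_subspace that by simp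
    have "scl L (B v e) f \<in> V i"
      using f_V that S by (simp add: subspace_scale)
    moreover have "P.proj v = v - scl L (B v e) f"
      using proj_V[of "m - 1"] that(3) m_pred by simp
    ultimately show ?thesis
      using subspace_diff[OF S, of v "scl L (B v e) f"] subspace_add[OF S, of "P.proj v" "scl L (B v e) f"]
      by auto
  qed
  \<comment> \<open>The reduction removes \<open>f\<close>, which lies in \<open>V 1\<close>, so the
    indices shift by one.\<close>
  define W where "W i = V (Suc i) \<inter> carr P.H" for i
  have proj_W: "P.proj v \<in> W i" if "Suc i < m" "v \<in> V (Suc i)" for i v
  proof -
    have "V (Suc i) \<subseteq> V (m - 1)"
      using that(1) by (intro V_mono) auto
    then show ?thesis
      using proj_V_iff[of "Suc i" v] that V_carr[of "Suc i" v] by (auto simp: W_def)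
  qed
  \<comment> \<open>One dimension is lost at the bottom with \<open>f\<close> and one at the top
    with \<open>e\<close>.\<close>
  define n where "n = m - 2"
  have n: "0 < n" "Suc n = m - 1" "Suc (n - 1) = m - 2" "Suc (Suc n) = m"
    using m2 by (simp_all add: n_def)
  have flag_H: "filiform_flag P.H n W"
    unfolding filiform_flag_def P.H_simps
  proof (intro conjI allI impI)
    show "0 < n" by (rule n(1))
    show "W n = grade P.H 1"
    proof
      show "W n \<subseteq> grade P.H 1"
        using V_odd[of "m - 1"] by (auto simp: W_def n P.H_grade simp del: P.H_grade_simps)
      show "grade P.H 1 \<subseteq> W n"
      proof
        fix X assume X: "X \<in> grade P.H 1"
        then have "X \<in> grade L 1" "B f X = 0" "X \<in> carr P.H"
          by auto
        then show "X \<in> W n"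
          using V_1_form_zero_iff[OF f P.f_nonzero] unfolding W_def n by blast
      qed
    qed
  next
    fix i assume "i \<le> n"
    then have i: "Suc i < m"
      using n by simp
    have S: "subspace (W i)"
      unfolding W_def using V_subspace[of "Suc i"] i P.H_carr_subspace by (intro subspace_inter) auto
    then show "subspace (W i)" .
    obtain T where T: "finite T" "\<And>i. i \<le> m \<Longrightarrow> V i \<subseteq> span T"
      by (rule V_finite) blast
    \<comment> \<open>\<open>V (Suc i)\<close> is the sum of \<open>W i\<close> and the line of
      \<open>f\<close>.\<close>
    have "dim (V (Suc i)) = Suc (dim (W i))"
    proof (rule dim_hyperplane[OF S _ _ _ T(1), of _ f])
      show "f \<notin> W i"
        using P.H_carr_simps(3)[of f] by (auto simp: W_def)
      show "\<exists>c. v - scl L c f \<in> W i" if "v \<in> V (Suc i)" for v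
        using proj_W[OF i that] proj_V[OF i that] by auto
    qed (use i T(2)[of "Suc i"] V_subspace[of "Suc i"] f_V in \<open>auto simp: W_def\<close>)
    then show "dim (W i) = i"
      using V_dim[of "Suc i"] i by simp
  next
    fix i assume "i < n"
    then have i: "Suc (Suc i) < m"
      using n by simp
    show "W i \<subseteq> W (Suc i)"
      using V_Suc[of "Suc i"] i by (auto simp: W_def)
    let ?G = "{P.proj (brk L X v) |X v. X \<in> grade P.H 0 \<and> v \<in> W (Suc i)}"
    \<comment> \<open>The span condition is pulled back along the projection, so that generation in
      the flag of \<open>L\<close> applies. Replacing \<open>v\<close> by its projection, which lies
      in \<open>W (Suc i)\<close>, does not change the bracket.\<close>
    have "V (Suc i) \<subseteq> {w \<in> carr L. P.proj w \<in> span ?G}"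
    proof (rule V_minimal)
      show "subspace {w \<in> carr L. P.proj w \<in> span ?G}"
        by (auto simp: subspace_def span_zero span_add span_scale)
      fix X v assume X: "X \<in> grade L 0" and v: "v \<in> V (Suc (Suc i))"
      then have vc: "v \<in> carr L" and "B f v = 0"
        using V_carr[of "Suc (Suc i)"] form_f[OF i] i by auto
      then have "P.proj (brk L X v) = P.proj (brk L X (P.proj v))"
        using X by simp
      moreover have "P.proj v \<in> W (Suc i)"
        using proj_W[OF i v] .
      ultimately have "P.proj (brk L X v) \<in> ?G"
        using X P.H_grade_0 by blast
      then show "brk L X v \<in> {w \<in> carr L. P.proj w \<in> span ?G}"
        using X vc span_base by simp
    qed (use i in simp)
    then have "W i \<subseteq> span ?G"
      by (force simp: W_def)
    moreover have "span ?G \<subseteq> W i"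
    proof (rule span_minimal)
      show "?G \<subseteq> W i"
        using proj_W[of i] brk_V[of "Suc i"] i by (auto simp: W_def P.H_grade_0 simp del: P.H_grade_simps)
      show "subspace (W i)"
        unfolding W_def using V_subspace[of "Suc i"] i P.H_carr_subspace by (intro subspace_inter) auto
    qed
    ultimately show "span ?G = W i" by blast
  qed
  \<comment> \<open>Otherwise the even part would send \<open>e\<close> into
    \<open>V (m - 2)\<close>. It sends \<open>V (m - 1)\<close> there anyway, so
    \<open>V (m - 1)\<close> would be contained in \<open>V (m - 2)\<close>.\<close>
  have "\<exists>X\<in>grade P.H 0. P.D X \<in> W n - W (n - 1)"
  proof (rule ccontr)
    assume no: "\<not> (\<exists>X\<in>grade P.H 0. P.D X \<in> W n - W (n - 1))"
    have eX: "brk L X e \<in> V (m - 2)" if X: "X \<in> grade L 0" for X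
    proof -
      have Xe: "brk L X e \<in> V (m - 1)"
        using brk_V[of "m - 1" X e] X e m_pred by simp
      have eX: "brk L e X = - brk L X e"
        using brk_skew_even[OF X, of e] by simp
      then have "brk L e X \<in> V (m - 1)"
        using Xe V_subspace[of "m - 1"] subspace_neg by simp
      \<comment> \<open>\<open>D X\<close> and \<open>[e,X]\<close> differ by a multiple of
        \<open>f\<close>, which lies in \<open>V (m - 2)\<close> because
        \<open>m > 2\<close>.\<close>
      then have "P.D X \<in> W n" and *: "P.D X \<in> V (m - 2) \<longleftrightarrow> brk L e X \<in> V (m - 2)"
        using proj_W[of n] proj_V_iff[of "m - 2"] n m2 by (simp_all add: P.D_def)
      then have "P.D X \<in> W (n - 1)"
        using no X unfolding P.H_grade_0 by blast
      then have "brk L e X \<in> V (m - 2)"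
        using * unfolding W_def n by blast
      then show ?thesis
        using eX subspace_neg[OF V_subspace, of "m - 2" "brk L e X"] by simp
    qed
    have "V (m - 1) \<subseteq> V (m - 2)"
    proof (rule V_minimal)
      fix X v assume X: "X \<in> grade L 0" and "v \<in> V (Suc (m - 1))"
      then have v: "v \<in> V m"
        using m_pred by simp
      then obtain c where c: "v - scl L c e \<in> V (m - 1)"
        using V_complement[of "m - 1" e v] e m_pred by auto
      then have "brk L X (v - scl L c e) \<in> V (m - 2)"
        using brk_V[of "m - 2" X] X n by simp
      moreover have "brk L X v = brk L X (v - scl L c e) + scl L c (brk L X e)"
        using X V_carr[OF _ v] by simp
      ultimately show "brk L X v \<in> V (m - 2)"
        using eX[OF X] V_subspace[of "m - 2"] by (simp add: subspace_add subspace_scale)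
    qed (use m_pred V_subspace in auto)
    then show False
      using V_proper[of "m - 1"] m2 by (simp add: numeral_2_eq_2)
  qed
  then have ext: "generalized_double_extension_of L B \<omega> e P.H B \<omega>"
    using P.generalized_double_extension[OF flag_H] sq by blast
  show ?thesis
  proof (intro exI conjI)
    show "quadratic_symplectic P.H B \<omega>"
      unfolding quadratic_symplectic_def using P.H_quadratic P.H_symplectic ..
    show "filiform_flag P.H n W" by (fact flag_H)
    show "finite_dim P.H" by (fact P.finite_dim_H(1)[OF finite_dim])
    show "vector_space.dim (scl P.H) (carr P.H) + 2 = dim (carr L)"
      unfolding P.H_simps by (fact P.finite_dim_H(2)[OF finite_dim])
  qed (fact e ext)+
qed

end

theorem theorem5p2:
  fixes L :: "('k::field_char_0, 'a::ab_group_add) superalgebra"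
    and B \<omega> :: "'a \<Rightarrow> 'a \<Rightarrow> 'k"
    and m :: nat and V :: "nat \<Rightarrow> 'a set"
  assumes "finite_dim L"
    and "quadratic_symplectic L B \<omega>"
    and "filiform_flag L m V"
  shows "(vector_space.dim (scl L) (grade L 1) = 2 \<longrightarrow>
            elementary_odd_double_extension L B \<omega>) \<and>
         (vector_space.dim (scl L) (grade L 1) > 2 \<longrightarrow>
            (\<exists>(H :: ('k, 'a) superalgebra) B\<^sub>H \<omega>\<^sub>H e\<^sub>m.
               quadratic_symplectic H B\<^sub>H \<omega>\<^sub>H \<and> (\<exists>n W. filiform_flag H n W) \<and>
               finite_dim H \<and>
               vector_space.dim (scl H) (carr H) + 2 = vector_space.dim (scl L) (carr L) \<and>
               e\<^sub>m \<in> V m - V (m - 1) \<and>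
               generalized_double_extension_of L B \<omega> e\<^sub>m H B\<^sub>H \<omega>\<^sub>H))"
proof -
  have dim: "vector_space.dim (scl L) (grade L 1) = m"
    using assms(3) unfolding filiform_flag_def by auto
  have sym: "symplectic L \<omega>" and quad: "quadratic L B"
    using assms(2) by (simp_all add: quadratic_symplectic_def)
  have lie: "lie_superalgebra L"
    using quad by (simp add: quadratic_def)
  have fil: "filiform_quadratic L B m V" if "2 \<le> m"
    by unfold_locales (fact lie quad assms(1,3) that)+
  show ?thesis
    unfolding dim
  proof (intro conjI impI)
    assume "m = 2"
    then show "elementary_odd_double_extension L B \<omega>"
      by (intro filiform_quadratic.elementary_case[OF fil sym]) simp_all
  next
    assume "m > 2"
    then show "\<exists>(H :: ('k, 'a) superalgebra) B\<^sub>H \<omega>\<^sub>H e\<^sub>m.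
      quadratic_symplectic H B\<^sub>H \<omega>\<^sub>H \<and> (\<exists>n W. filiform_flag H n W) \<and> finite_dim H \<and>
      vector_space.dim (scl H) (carr H) + 2 = vector_space.dim (scl L) (carr L) \<and>
      e\<^sub>m \<in> V m - V (m - 1) \<and> generalized_double_extension_of L B \<omega> e\<^sub>m H B\<^sub>H \<omega>\<^sub>H"
      by (intro filiform_quadratic.generalized_case[OF fil sym]) simp_all
  qed
qed

end
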